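(* Let $(H_{\mathbb R},H_{\mathbb C},F^\bullet,W_\bullet,M,S)$ be a Steenbrink PMHS of weight $m$, with automorphism $G$ and normalized Seifert form $L^{nor}$ as defined in the context. (a) For $a\in H_\lambda$, $b\in H_{\overline\lambda}$ with $\lambda=e^{-2\pi i\alpha}$ and $0<\alpha<1$, $$S(a,b)=\frac{-1}{2\pi i}\cdot e^{-\pi i\alpha}\cdot L^{nor}(Ga,e^{-N/2}Gb).$$ For $a,b\in H_1$, $S(a,b)=L^{nor}(Ga,e^{-N/2}Gb)$. (b) $(H_{\mathbb R},H_{\mathbb C},G(F^\bullet),W_\bullet,M)$ is a Steenbrink MHS of weight $m$ with $$L^{sym}_{\kappa\cdot i^{m-1}}\bigl(G(F^p)H_\lambda,G(F^{m+1-p})H_{\overline\lambda}\bigr)=0\quad\text{for }\lambda\ne1\text{ and }\kappa\text{ with }\kappa^2=\lambda,$$ $$L^{sym}_{i^{m-1}}\bigl(G(F^p)H_1,G(F^{m+2-p})H_1\bigr)=0.$$ (c) Let $p,q,\lambda$ be such that $(I_0^{p,q})_\lambda\ne\{0\}$, put $l:=p+q-m-\theta(\lambda)\geq 0$, and let $\alpha\in\mathbb{R}$ satisfy $e^{-2\pi i\alpha}=\lambda$ and $\lfloor m-\alpha\rfloor=p$. For $a\in(I_0^{p,q})_\lambda\setminus\{0\}$ as well as for $a\in G((I_0^{p,q})_\lambda)\setminus\{0\}$, $$L^{nor}(a,N^l\overline a)\in e^{\frac12\pi i(2\alpha+l+1-m)}\cdot\mathbb{R}_{>0}.$$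
   Context: Notation: $\theta(1)=1$, $\theta(\lambda)=0$ for $\lambda\in S^1\setminus\{1\}$. For an automorphism $M$ of a finite dimensional real space $H_{\mathbb R}$ with complexification $H_{\mathbb C}$: $M=M_sM_u=M_uM_s$ (semisimple, unipotent), $N=\log M_u$, $H_\lambda=\ker(M_s-\lambda\,\mathrm{id})\subset H_{\mathbb C}$, $H_{\ne1}=\bigoplus_{\lambda\ne1}H_\lambda$. $H_\lambda$ always refers to $M$. For a nilpotent $N$ and $w\in\mathbb{Z}$, $W^{(N,w)}_\bullet$ is the unique increasing filtration with $N(W_k)\subset W_{k-2}$ and $N^l:\mathrm{Gr}^W_{w+l}\to\mathrm{Gr}^W_{w-l}$ an isomorphism for $l\ge0$; $P_{w+l}=\ker(N^{l+1}:\mathrm{Gr}^W_{w+l}\to\mathrm{Gr}^W_{w-l-2})$ for $l\ge0$. If $N$ is an infinitesimal isometry of a nondegenerate $(-1)^w$-symmetric form $S$, then $S_l(a,b)=S(\tilde a,N^l\tilde b)$ ($\tilde a,\tilde b\in W_{w+l}$ representatives) is well defined on $\mathrm{Gr}^W_{w+l}$. A mixed Hodge structure (MHS) $(H_{\mathbb R},H_{\mathbb C},F^\bullet,W_\bullet)$: decreasing filtration $F^\bullet$ of $H_{\mathbb C}$, increasing filtration $W_\bullet$ of $H_{\mathbb R}$, such that $F^\bullet\mathrm{Gr}^W_k$ is a pure Hodge structure of weight $k$. A polarized MHS (PMHS) of weight $w$ $(H_{\mathbb R},H_{\mathbb C},F^\bullet,W_\bullet,N,S)$: a MHS with $W_\bullet=W_\bullet^{(N,w)}$,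 $S$ nondegenerate $(-1)^w$-symmetric on $H_{\mathbb R}$, $N$ a nilpotent infinitesimal isometry of $S$, $N(F^p)\subset F^{p-1}$, $S(F^p,F^{w+1-p})=0$, and $i^{2p-w-l}S_l(a,\overline a)>0$ for $0\ne a\in F^pP_{w+l}\cap\overline{F^{w+l-p}P_{w+l}}$. A Steenbrink MHS of weight $m$: a MHS with an automorphism $M$ of $(H_{\mathbb R},H_{\mathbb C},W_\bullet)$ such that $M_s(F^p)\subset F^p$, $N(F^p)\subset F^{p-1}$, $W_\bullet=W_\bullet^{(N,m)}$ on $H_{\ne1}$, $W_\bullet=W_\bullet^{(N,m+1)}$ on $H_1$. A Steenbrink PMHS of weight $m$: a Steenbrink MHS with a nondegenerate $M$-invariant bilinear form $S$ on $H_{\mathbb R}$ such that the restriction to $H_{\ne1}$ is a PMHS of weight $m$ and the restriction to $H_1$ is a PMHS of weight $m+1$. All eigenvalues of $M$ are then in $S^1$. Automorphism $G:H_{\mathbb C}\to H_{\mathbb C}$: on $H_{e^{-2\pi i\alpha}}$ with $\alpha\in(0,1]$ it is $G^{(\alpha)}=\sum_{k\ge0}\frac1{k!}\Gamma^{(k)}(\alpha)\left(\frac{-N}{2\pi i}\right)^k=\Gamma(\alpha\,\mathrm{id}-\frac N{2\pi i})$, with $\Gamma$ the Gamma function. Normalized Seifert form: $L^{nor}(a,b)=-S(a,\nu^{-1}b)$ with $\nu=\frac1{M-\mathrm{id}}$ on $H_{\ne1}$ and $\nu=\frac{-N}{M-\mathrm{id}}$ on $H_1$ (i.e. $-\nu^{-1}=\frac{M-\mathrm{id}}N:=\sum_{k\ge1}\frac1{k!}N^{k-1}$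 on $H_1$). Its monodromy (the automorphism with $L^{nor}(M^{nor}a,b)=L^{nor}(b,a)$) is $M^{nor}=(-1)^{m+1}M$. For $\rho$ with $\rho^2=(-1)^{m+1}\lambda$ the pairing $L^{sym}_\rho:H_\lambda\times H_{1/\lambda}\to\mathbb{C}$ is $L^{sym}_\rho(a,b)=\rho\cdot L^{nor}(a,e^{-N/2}b)$. $G(F^p)H_\lambda$ means $G(F^p\cap H_\lambda)$. Deligne's subspaces: $I^{p,q}=(F^p\cap W_{p+q})\cap\bigl(\overline F^q\cap W_{p+q}+\sum_{j>0}\overline F^{q-j}\cap W_{p+q-j-1}\bigr)$. For $p+q\ge m+\theta(\lambda)$: $(I_0^{p,q})_\lambda=\{a\in I^{p,q}\cap H_\lambda:N^{p+q-m-\theta(\lambda)+1}a=0\}$. *)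

theory Defs
  imports "HOL-Analysis.Analysis"
begin

(* Complexification.  For a real vector space H the complexification is H \<times> H, where (x, y)
   stands for x + i y; the library's real vector space structure on pairs supplies addition.
   A real subspace U becomes U \<times> U, and a real endomorphism f becomes map_prod f f.
   Substructures (such as the restriction to H_1) are described by a real subspace U
   of the ambient H. *)

definition cscale :: "complex \<Rightarrow> 'a::real_vector \<times> 'a \<Rightarrow> 'a \<times> 'a" where
  "cscale c v = (Re c *\<^sub>R fst v - Im c *\<^sub>R snd v, Re c *\<^sub>R snd v + Im c *\<^sub>R fst v)"

global_interpretation cvec: vector_space "cscale :: complex \<Rightarrow> 'a::real_vector \<times> 'a \<Rightarrow> 'a \<times> 'a"
  by unfold_locales (auto simp: cscale_def algebra_simps prod_eq_iff)

definition cconj :: "'a::real_vector \<times> 'a \<Rightarrow> 'a \<times> 'a" where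
  "cconj v = (fst v, - snd v)"

abbreviation cext :: "('a \<Rightarrow> 'a) \<Rightarrow> 'a \<times> 'a \<Rightarrow> 'a \<times> 'a" where
  "cext f \<equiv> map_prod f f"

definition real_points :: "('a::real_vector \<times> 'a) set \<Rightarrow> 'a set" where
  "real_points V = {x. (x, 0) \<in> V}"

(* complex bilinear (not sesquilinear) extension *)
definition bext :: "('a::real_vector \<Rightarrow> 'a \<Rightarrow> real) \<Rightarrow> 'a \<times> 'a \<Rightarrow> 'a \<times> 'a \<Rightarrow> complex" where
  "bext S v w = Complex (S (fst v) (fst w) - S (snd v) (snd w))
                        (S (fst v) (snd w) + S (snd v) (fst w))"

definition pos_reals :: "complex set" where
  "pos_reals = complex_of_real ` {0<..}"


(* M = Ms Mu = Mu Ms.  Semisimplicity over the reals means diagonalizability of the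
   complexification. *)

definition eigenspace :: "('a::real_vector \<Rightarrow> 'a) \<Rightarrow> complex \<Rightarrow> ('a \<times> 'a) set" where
  "eigenspace f \<zeta> = {v. cext f v = cscale \<zeta> v}"

definition semisimple :: "('a::real_vector \<Rightarrow> 'a) \<Rightarrow> bool" where
  "semisimple f \<longleftrightarrow> linear f \<and> cvec.span (\<Union>\<zeta>. eigenspace f \<zeta>) = UNIV"

definition unipotent :: "('a::real_vector \<Rightarrow> 'a) \<Rightarrow> bool" where
  "unipotent f \<longleftrightarrow> linear f \<and> (\<exists>n. \<forall>x. ((\<lambda>y. f y - y) ^^ n) x = 0)"

definition jordan_decomposition ::
  "('a::real_vector \<Rightarrow> 'a) \<Rightarrow> ('a \<Rightarrow> 'a) \<Rightarrow> ('a \<Rightarrow> 'a) \<Rightarrow> bool" where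
  "jordan_decomposition M Ms Mu \<longleftrightarrow>
     semisimple Ms \<and> unipotent Mu \<and> M = Ms \<circ> Mu \<and> M = Mu \<circ> Ms"

(* log (1 + X) = sum of (-1)^(k+1)/k X^k over k \<ge> 1, with X = u - 1 nilpotent;
   only the nonzero terms are summed, so that the index set is finite *)
definition log_unipotent :: "('a::real_vector \<Rightarrow> 'a) \<Rightarrow> 'a \<Rightarrow> 'a" where
  "log_unipotent u x =
     (let X = (\<lambda>y. u y - y)
      in \<Sum>k\<in>{k. k \<ge> 1 \<and> (X ^^ k) x \<noteq> 0}. ((- 1) ^ (k + 1) / real k) *\<^sub>R (X ^^ k) x)"

(* value at v of the power series with coefficients c k in the complexification of a
   nilpotent N, again summed over the finitely many k with N^k v \<noteq> 0 *)
definition nil_series ::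
  "(nat \<Rightarrow> complex) \<Rightarrow> ('a::real_vector \<Rightarrow> 'a) \<Rightarrow> 'a \<times> 'a \<Rightarrow> 'a \<times> 'a" where
  "nil_series c N v =
     (\<Sum>k\<in>{k. (cext N ^^ k) v \<noteq> 0}. cscale (c k) ((cext N ^^ k) v))"

definition H_ne1 :: "('a::real_vector \<Rightarrow> 'a) \<Rightarrow> ('a \<times> 'a) set" where
  "H_ne1 Ms = cvec.span (\<Union>\<zeta>\<in>- {1}. eigenspace Ms \<zeta>)"

(* component of v in eigenspace Ms \<zeta> with respect to the eigenspace decomposition *)
definition component :: "('a::real_vector \<Rightarrow> 'a) \<Rightarrow> complex \<Rightarrow> 'a \<times> 'a \<Rightarrow> 'a \<times> 'a" where
  "component Ms \<zeta> v =
     (THE u. u \<in> eigenspace Ms \<zeta> \<and> v - u \<in> cvec.span (\<Union>\<mu>\<in>- {\<zeta>}. eigenspace Ms \<mu>))"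


(* Filtrations are finite: exhaustive and separated. *)

definition incr_filtration :: "'a::real_vector set \<Rightarrow> (int \<Rightarrow> 'a set) \<Rightarrow> bool" where
  "incr_filtration U W \<longleftrightarrow>
     mono W \<and> (\<forall>k. subspace (W k)) \<and> (\<exists>k. W k = {0}) \<and> (\<exists>k. W k = U)"

definition decr_filtration :: "'a::real_vector set \<Rightarrow> (int \<Rightarrow> ('a \<times> 'a) set) \<Rightarrow> bool" where
  "decr_filtration U F \<longleftrightarrow>
     antimono F \<and> (\<forall>p. cvec.subspace (F p)) \<and> (\<exists>p. F p = {0}) \<and> (\<exists>p. F p = U \<times> U)"

(* Subspaces of the quotient Gr_k = W_k / W_{k-1} are represented throughout by their
   preimages in W_k; thus 0 becomes W_{k-1}, and a nonzero class is one whose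
   representatives do not lie in W_{k-1}. *)

abbreviation cW :: "(int \<Rightarrow> 'a set) \<Rightarrow> int \<Rightarrow> ('a \<times> 'a) set" where
  "cW W k \<equiv> W k \<times> W k"

definition F_Gr :: "(int \<Rightarrow> ('a::real_vector \<times> 'a) set) \<Rightarrow> (int \<Rightarrow> 'a set) \<Rightarrow> int \<Rightarrow> int \<Rightarrow> ('a \<times> 'a) set" where
  "F_Gr F W p k = F p \<inter> cW W k + cW W (k - 1)"

(* F^p Gr_k and the conjugate of F^{k+1-p} Gr_k are complementary in Gr_k for all p *)
definition pure_on_Gr :: "(int \<Rightarrow> ('a::real_vector \<times> 'a) set) \<Rightarrow> (int \<Rightarrow> 'a set) \<Rightarrow> int \<Rightarrow> bool" where
  "pure_on_Gr F W k \<longleftrightarrow>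
     (\<forall>p. F_Gr F W p k + cconj ` F_Gr F W (k + 1 - p) k = cW W k \<and>
          F_Gr F W p k \<inter> cconj ` F_Gr F W (k + 1 - p) k = cW W (k - 1))"

definition MHS :: "'a::real_vector set \<Rightarrow> (int \<Rightarrow> ('a \<times> 'a) set) \<Rightarrow> (int \<Rightarrow> 'a set) \<Rightarrow> bool" where
  "MHS U F W \<longleftrightarrow>
     subspace U \<and> decr_filtration U F \<and> incr_filtration U W \<and> (\<forall>k. pure_on_Gr F W k)"

definition nilpotent_on :: "'a::real_vector set \<Rightarrow> ('a \<Rightarrow> 'a) \<Rightarrow> bool" where
  "nilpotent_on U N \<longleftrightarrow> linear N \<and> N ` U \<subseteq> U \<and> (\<exists>n. \<forall>x\<in>U. (N ^^ n) x = 0)"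

(* W is the (unique) filtration W^{(N,w)} of U; the last two conjuncts say that
   N^l : Gr_{w+l} \<rightarrow> Gr_{w-l} is injective and surjective *)
definition weight_filtration ::
  "'a::real_vector set \<Rightarrow> ('a \<Rightarrow> 'a) \<Rightarrow> int \<Rightarrow> (int \<Rightarrow> 'a set) \<Rightarrow> bool" where
  "weight_filtration U N w W \<longleftrightarrow>
     incr_filtration U W \<and> (\<forall>k. N ` W k \<subseteq> W (k - 2)) \<and>
     (\<forall>l::nat.
        (\<forall>x\<in>W (w + int l). (N ^^ l) x \<in> W (w - int l - 1) \<longrightarrow> x \<in> W (w + int l - 1)) \<and>
        (N ^^ l) ` W (w + int l) + W (w - int l - 1) = W (w - int l))"

(* preimage in W_{w+l} of the primitive part P_{w+l}, complexified *)
definition primitive ::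
  "('a::real_vector \<Rightarrow> 'a) \<Rightarrow> int \<Rightarrow> (int \<Rightarrow> 'a set) \<Rightarrow> nat \<Rightarrow> ('a \<times> 'a) set" where
  "primitive N w W l = {v \<in> cW W (w + int l). (cext N ^^ (l + 1)) v \<in> cW W (w - int l - 3)}"

definition F_prim ::
  "(int \<Rightarrow> ('a::real_vector \<times> 'a) set) \<Rightarrow> (int \<Rightarrow> 'a set) \<Rightarrow> ('a \<Rightarrow> 'a) \<Rightarrow> int \<Rightarrow> nat \<Rightarrow> int \<Rightarrow> ('a \<times> 'a) set" where
  "F_prim F W N w l p = F_Gr F W p (w + int l) \<inter> primitive N w W l"

definition nondegenerate_on :: "'a::real_vector set \<Rightarrow> ('a \<Rightarrow> 'a \<Rightarrow> real) \<Rightarrow> bool" where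
  "nondegenerate_on U S \<longleftrightarrow>
     (\<forall>x\<in>U. (\<forall>y\<in>U. S x y = 0) \<longrightarrow> x = 0) \<and> (\<forall>y\<in>U. (\<forall>x\<in>U. S x y = 0) \<longrightarrow> y = 0)"

definition PMHS ::
  "'a::real_vector set \<Rightarrow> (int \<Rightarrow> ('a \<times> 'a) set) \<Rightarrow> (int \<Rightarrow> 'a set) \<Rightarrow> ('a \<Rightarrow> 'a)
     \<Rightarrow> ('a \<Rightarrow> 'a \<Rightarrow> real) \<Rightarrow> int \<Rightarrow> bool" where
  "PMHS U F W N S w \<longleftrightarrow>
     MHS U F W \<and> nilpotent_on U N \<and> weight_filtration U N w W \<and>
     bilinear S \<and> nondegenerate_on U S \<and>
     (\<forall>x\<in>U. \<forall>y\<in>U. S x y = (- 1) powi w * S y x) \<and>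
     (\<forall>x\<in>U. \<forall>y\<in>U. S (N x) y + S x (N y) = 0) \<and>
     (\<forall>p. cext N ` F p \<subseteq> F (p - 1)) \<and>
     (\<forall>p. \<forall>a\<in>F p. \<forall>b\<in>F (w + 1 - p). bext S a b = 0) \<and>
     (\<forall>p l. \<forall>a \<in> F_prim F W N w l p \<inter> cconj ` F_prim F W N w l (w + int l - p).
        a \<notin> cW W (w + int l - 1) \<longrightarrow>
        \<i> powi (2 * p - w - int l) * bext S a ((cext N ^^ l) (cconj a)) \<in> pos_reals)"


(* In the following N is meant to be log_unipotent Mu, for the decomposition M = Ms Mu. *)

abbreviation H1_real :: "('a::real_vector \<Rightarrow> 'a) \<Rightarrow> 'a set" where
  "H1_real Ms \<equiv> real_points (eigenspace Ms 1)"

abbreviation Hne1_real :: "('a::real_vector \<Rightarrow> 'a) \<Rightarrow> 'a set" where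
  "Hne1_real Ms \<equiv> real_points (H_ne1 Ms)"

definition Steenbrink_MHS ::
  "int \<Rightarrow> (int \<Rightarrow> ('a::real_vector \<times> 'a) set) \<Rightarrow> (int \<Rightarrow> 'a set) \<Rightarrow> ('a \<Rightarrow> 'a) \<Rightarrow> ('a \<Rightarrow> 'a)
     \<Rightarrow> ('a \<Rightarrow> 'a) \<Rightarrow> bool" where
  "Steenbrink_MHS m F W M Ms N \<longleftrightarrow>
     MHS UNIV F W \<and> linear M \<and> bij M \<and> (\<forall>k. M ` W k = W k) \<and>
     (\<forall>p. cext Ms ` F p \<subseteq> F p) \<and> (\<forall>p. cext N ` F p \<subseteq> F (p - 1)) \<and>
     weight_filtration (Hne1_real Ms) N m (\<lambda>k. W k \<inter> Hne1_real Ms) \<and>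
     weight_filtration (H1_real Ms) N (m + 1) (\<lambda>k. W k \<inter> H1_real Ms)"

definition Steenbrink_PMHS ::
  "int \<Rightarrow> (int \<Rightarrow> ('a::real_vector \<times> 'a) set) \<Rightarrow> (int \<Rightarrow> 'a set) \<Rightarrow> ('a \<Rightarrow> 'a) \<Rightarrow> ('a \<Rightarrow> 'a)
     \<Rightarrow> ('a \<Rightarrow> 'a) \<Rightarrow> ('a \<Rightarrow> 'a \<Rightarrow> real) \<Rightarrow> bool" where
  "Steenbrink_PMHS m F W M Ms N S \<longleftrightarrow>
     Steenbrink_MHS m F W M Ms N \<and>
     bilinear S \<and> nondegenerate_on UNIV S \<and> (\<forall>x y. S (M x) (M y) = S x y) \<and>
     PMHS (Hne1_real Ms) (\<lambda>p. F p \<inter> H_ne1 Ms) (\<lambda>k. W k \<inter> Hne1_real Ms) N S m \<and>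
     PMHS (H1_real Ms) (\<lambda>p. F p \<inter> eigenspace Ms 1) (\<lambda>k. W k \<inter> H1_real Ms) N S (m + 1)"


definition theta :: "complex \<Rightarrow> int" where
  "theta \<zeta> = (if \<zeta> = 1 then 1 else 0)"

(* the \<alpha> in (0,1] with e^{-2 \<pi> i \<alpha>} = \<zeta>; unspecified unless |\<zeta>| = 1 *)
definition spec_alpha :: "complex \<Rightarrow> real" where
  "spec_alpha \<zeta> = (THE \<alpha>. 0 < \<alpha> \<and> \<alpha> \<le> 1 \<and> exp (- 2 * pi * \<i> * \<alpha>) = \<zeta>)"

definition G_alpha :: "('a::real_vector \<Rightarrow> 'a) \<Rightarrow> real \<Rightarrow> 'a \<times> 'a \<Rightarrow> 'a \<times> 'a" where
  "G_alpha N \<alpha> =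
     nil_series (\<lambda>k. 1 / fact k * (deriv ^^ k) Gamma (complex_of_real \<alpha>) * (- 1 / (2 * pi * \<i>)) ^ k) N"

definition G_op :: "('a::real_vector \<Rightarrow> 'a) \<Rightarrow> ('a \<Rightarrow> 'a) \<Rightarrow> 'a \<times> 'a \<Rightarrow> 'a \<times> 'a" where
  "G_op Ms N v =
     (\<Sum>\<zeta>\<in>{\<zeta>. component Ms \<zeta> v \<noteq> 0}. G_alpha N (spec_alpha \<zeta>) (component Ms \<zeta> v))"

(* M - id on H_ne1, and minus the sum of 1/k! N^(k-1) over k \<ge> 1 on H_1 *)
definition nu_inv :: "('a::real_vector \<Rightarrow> 'a) \<Rightarrow> ('a \<Rightarrow> 'a) \<Rightarrow> ('a \<Rightarrow> 'a) \<Rightarrow> 'a \<times> 'a \<Rightarrow> 'a \<times> 'a" where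
  "nu_inv M Ms N v =
     (let v1 = component Ms 1 v; v' = v - v1
      in (cext M v' - v') - nil_series (\<lambda>k. 1 / fact (k + 1)) N v1)"

definition L_nor ::
  "('a::real_vector \<Rightarrow> 'a) \<Rightarrow> ('a \<Rightarrow> 'a) \<Rightarrow> ('a \<Rightarrow> 'a) \<Rightarrow> ('a \<Rightarrow> 'a \<Rightarrow> real)
     \<Rightarrow> 'a \<times> 'a \<Rightarrow> 'a \<times> 'a \<Rightarrow> complex" where
  "L_nor M Ms N S a b = - bext S a (nu_inv M Ms N b)"

definition exp_half :: "('a::real_vector \<Rightarrow> 'a) \<Rightarrow> 'a \<times> 'a \<Rightarrow> 'a \<times> 'a" where
  "exp_half N = nil_series (\<lambda>k. (- 1 / 2) ^ k / fact k) N"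

definition L_sym ::
  "('a::real_vector \<Rightarrow> 'a) \<Rightarrow> ('a \<Rightarrow> 'a) \<Rightarrow> ('a \<Rightarrow> 'a) \<Rightarrow> ('a \<Rightarrow> 'a \<Rightarrow> real)
     \<Rightarrow> complex \<Rightarrow> 'a \<times> 'a \<Rightarrow> 'a \<times> 'a \<Rightarrow> complex" where
  "L_sym M Ms N S \<rho> a b = \<rho> * L_nor M Ms N S a (exp_half N b)"

(* Deligne's subspaces; the sum over all j > 0 is the span of the union *)
definition Deligne_I ::
  "(int \<Rightarrow> ('a::real_vector \<times> 'a) set) \<Rightarrow> (int \<Rightarrow> 'a set) \<Rightarrow> int \<Rightarrow> int \<Rightarrow> ('a \<times> 'a) set" where
  "Deligne_I F W p q =
     (F p \<inter> cW W (p + q)) \<inter>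
     (cconj ` F q \<inter> cW W (p + q) +
      cvec.span (\<Union>j\<in>{0<..}. cconj ` F (q - j) \<inter> cW W (p + q - j - 1)))"

(* meaningful for p + q \<ge> m + theta \<zeta> *)
definition Deligne_I0 ::
  "int \<Rightarrow> (int \<Rightarrow> ('a::real_vector \<times> 'a) set) \<Rightarrow> (int \<Rightarrow> 'a set) \<Rightarrow> ('a \<Rightarrow> 'a) \<Rightarrow> ('a \<Rightarrow> 'a)
     \<Rightarrow> int \<Rightarrow> int \<Rightarrow> complex \<Rightarrow> ('a \<times> 'a) set" where
  "Deligne_I0 m F W Ms N p q \<zeta> =
     {a \<in> Deligne_I F W p q \<inter> eigenspace Ms \<zeta>.
        (cext N ^^ nat (p + q - m - theta \<zeta> + 1)) a = 0}"

end

theory Submission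
  imports Defs "HOL-Complex_Analysis.Complex_Analysis"
begin

text \<open>
The proof works on one eigenspace \<open>H\<^sub>\<lambda>\<close> of the semisimple part at a time and treats every operator on
it as a formal power series in the nilpotent \<open>N\<close>. The assignment \<open>f \<mapsto> f(N)\<close> turns products of
series into composites of operators and substitution of series into substitution of operators;
in particular the unipotent part of \<open>M\<close> is \<open>exp N\<close>. Because \<open>N\<close> is an infinitesimal isometry, moving
\<open>f(N)\<close> to the other argument of \<open>S\<close> replaces \<open>f(z)\<close> by \<open>f(-z)\<close>. For \<open>\<lambda> = exp(-2\<pi>i\<alpha>)\<close> with
\<open>0 < \<alpha> < 1\<close> the number \<open>L(G a, exp(-N/2) G b)\<close> is therefore \<open>- S(a, f(N) b)\<close>, where
\<open>f(z) = \<Gamma>(x) \<Gamma>(1 - x) (exp(2\<pi>i\<alpha>) exp(z) - 1) exp(-z/2)\<close> and \<open>x = \<alpha> + z/2\<pi>i\<close>. The last two factors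
multiply to \<open>2i exp(\<pi>i\<alpha>) sin(\<pi>x)\<close>, so Euler's reflection formula makes \<open>f\<close> a constant
(\<open>gamma_fps_reflection\<close>); on \<open>H\<^sub>1\<close> the same computation, divided by \<open>z\<close>, gives the constant 1
(\<open>gamma_fps_reflection_one\<close>). This is part (a), in the form of \<open>L_nor_G_ne1\<close> and \<open>L_nor_G_one\<close>, and
it reduces the vanishing statements of part (b) to \<open>S(F\<^sup>p, F\<^bsup>w+1-p\<^esup>) = 0\<close>.

For the mixed Hodge structure in part (b), note that on \<open>H\<^sub>\<lambda>\<close> the operator \<open>G\<close> is the scalar
\<open>\<Gamma>(\<alpha>)\<close> plus a multiple of \<open>N\<close>, and \<open>N\<close> lowers weights. So \<open>F\<close> and \<open>G(F)\<close> induce the same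
filtration on every graded piece (\<open>F_Gr_G\<close>), and purity carries over. This uses \<open>\<Gamma>(\<alpha>) \<noteq> 0\<close>, hence
\<open>\<alpha> \<in> (0,1]\<close>, hence that all eigenvalues lie on the unit circle (\<open>eigenvalue_unimodular\<close>). The
polarization yields the latter: eigenspaces pair to zero under \<open>S\<close> unless their eigenvalues are
inverse to each other, whereas a nonzero \<open>H\<^sub>\<lambda>\<close> contains a primitive vector \<open>a\<close> of pure Hodge type,
for which \<open>S(a, N\<^sup>l cnj a) \<noteq> 0\<close> (\<open>PMHS_projection_image_nonisotropic\<close>).

For part (c), a nonzero element of Deligne's \<open>I\<^bsup>p,q\<^esup>\<close> stays nonzero modulo lower weights
(\<open>Deligne_I_Int_lower\<close>), so for primitive \<open>a\<close> the polarization gives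
\<open>i\<^bsup>p-q\<^esup> S(a, N\<^sup>l cnj a) > 0\<close> (\<open>Deligne_I0_positive\<close>). Since \<open>N\<close> kills \<open>N\<^sup>l cnj a\<close>, the Seifert form is
here a scalar multiple of \<open>S\<close>, with factor 1 for \<open>\<lambda> = 1\<close> and \<open>1 - cnj \<lambda>\<close> otherwise, and the argument
of that factor is read off from \<open>1 - exp(2\<pi>i\<beta>) = 2 sin(\<pi>\<beta>) exp(\<pi>i(\<beta> - 1/2))\<close>. Replacing \<open>a\<close> by
\<open>G a\<close> only multiplies the value by \<open>|\<Gamma>(\<alpha>)|\<^sup>2\<close>, because all other terms contain \<open>N\<^bsup>l+1\<^esup>\<close>.
\<close>

section \<open>Complexified spaces, operators and forms\<close>

abbreviation clinear :: "('a::real_vector \<times> 'a \<Rightarrow> 'a \<times> 'a) \<Rightarrow> bool" where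
  "clinear \<equiv> Vector_Spaces.linear cscale cscale"

lemma clinearI:
  assumes "\<And>v w. T (v + w) = T v + T w" and "\<And>c v. T (cscale c v) = cscale c (T v)"
  shows "clinear T"
  by (unfold_locales) (auto simp: assms)

lemma clinear_module_hom: "clinear T \<Longrightarrow> module_hom cscale cscale T"
  by (simp add: module_hom_iff_linear)

lemmas clinear_add = module_hom.add[OF clinear_module_hom]
  and clinear_scale = module_hom.scale[OF clinear_module_hom]
  and clinear_zero = module_hom.zero[OF clinear_module_hom]
  and clinear_diff = module_hom.diff[OF clinear_module_hom]
  and clinear_sum = module_hom.sum[OF clinear_module_hom]
  and clinear_image = module_hom.subspace_image[OF clinear_module_hom]

lemma clinear_cext: "linear f \<Longrightarrow> clinear (cext f)"
  by (rule clinearI)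
    (auto simp: cscale_def linear_add linear_scale linear_diff prod_eq_iff)

lemma cext_funpow: "cext f ^^ n = cext (f ^^ n)"
  by (induction n) (auto simp: fun_eq_iff)

lemma clinear_funpow: "clinear T \<Longrightarrow> clinear (T ^^ n)"
proof (induction n)
  case 0
  show ?case by (rule clinearI) auto
next
  case (Suc n)
  note IH = Suc.IH[OF Suc.prems]
  show ?case
    by (intro clinearI)
      (simp_all add: clinear_add[OF IH] clinear_scale[OF IH] clinear_add[OF Suc.prems]
        clinear_scale[OF Suc.prems])
qed

lemma funpow_commuting:
  assumes "\<And>v. T (D v) = D (T v)"
  shows "(T ^^ m) ((D ^^ n) v) = (D ^^ n) ((T ^^ m) v)"
proof -
  have T: "T ((D ^^ n) v) = (D ^^ n) (T v)" for v
    by (induction n arbitrary: v) (auto simp: assms)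
  show ?thesis by (induction m arbitrary: v) (auto simp: T)
qed

lemma funpow_mem: "T ` V \<subseteq> V \<Longrightarrow> v \<in> V \<Longrightarrow> (T ^^ n) v \<in> V"
  by (induction n) auto

lemma subspace_complexification: "subspace U \<Longrightarrow> cvec.subspace (U \<times> U)"
  by (auto simp: cvec.subspace_def cscale_def zero_prod_def subspace_0 subspace_add subspace_diff subspace_scale)

lemma cconj_cconj [simp]: "cconj (cconj v) = v"
  and cconj_add [simp]: "cconj (v + w) = cconj v + cconj w"
  and cconj_diff [simp]: "cconj (v - w) = cconj v - cconj w"
  and cconj_cscale [simp]: "cconj (cscale c v) = cscale (cnj c) (cconj v)"
  and cconj_zero [simp]: "cconj 0 = 0"
  by (auto simp: cconj_def cscale_def prod_eq_iff)

lemma cconj_sum: "cconj (sum u A) = (\<Sum>z\<in>A. cconj (u z))"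
  by (induction A rule: infinite_finite_induct) auto

lemma cconj_eq_0_iff [simp]: "cconj v = 0 \<longleftrightarrow> v = 0"
  by (auto simp: cconj_def prod_eq_iff)

lemma cext_cconj: "linear f \<Longrightarrow> cext f (cconj v) = cconj (cext f v)"
  by (auto simp: cconj_def linear_neg prod_eq_iff)

lemma cext_funpow_cconj: "linear f \<Longrightarrow> (cext f ^^ n) (cconj v) = cconj ((cext f ^^ n) v)"
  by (induction n) (auto simp: cext_cconj)

lemma cconj_mem_image_iff: "cconj v \<in> A \<longleftrightarrow> v \<in> cconj ` A"
  by (metis cconj_cconj imageE imageI)

lemma cconj_mem_complexification [simp]:
  "subspace U \<Longrightarrow> cconj v \<in> U \<times> U \<longleftrightarrow> v \<in> U \<times> U"
  by (cases v) (auto simp: cconj_def dest: subspace_neg)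

lemma csubspace_cconj:
  assumes "cvec.subspace A"
  shows "cvec.subspace (cconj ` A)"
proof (rule cvec.subspaceI)
  show "0 \<in> cconj ` A"
    using cvec.subspace_0[OF assms] by (metis cconj_zero imageI)
next
  fix v w assume "v \<in> cconj ` A" "w \<in> cconj ` A"
  thus "v + w \<in> cconj ` A"
    using cvec.subspace_add[OF assms] by (auto simp flip: cconj_add)
next
  fix c v assume "v \<in> cconj ` A"
  then obtain a where "a \<in> A" "v = cconj a" by blast
  moreover have "cscale c (cconj a) = cconj (cscale (cnj c) a)" by simp
  ultimately show "cscale c v \<in> cconj ` A"
    using cvec.subspace_scale[OF assms] by (metis imageI)
qed

lemma csubspace_set_plus:
  assumes "cvec.subspace A" "cvec.subspace B"
  shows "cvec.subspace (A + B)"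
proof -
  have "A + B = {x + y |x y. x \<in> A \<and> y \<in> B}"
    unfolding set_plus_def by blast
  thus ?thesis using cvec.subspace_sums[OF assms] by simp
qed

lemma bext_add_left: "bilinear S \<Longrightarrow> bext S (v + v') w = bext S v w + bext S v' w"
  and bext_add_right: "bilinear S \<Longrightarrow> bext S v (w + w') = bext S v w + bext S v w'"
  and bext_diff_right: "bilinear S \<Longrightarrow> bext S v (w - w') = bext S v w - bext S v w'"
  by (auto simp: bext_def bilinear_ladd bilinear_radd bilinear_lsub bilinear_rsub complex_eq_iff)

lemma bext_scale_left: "bilinear S \<Longrightarrow> bext S (cscale c v) w = c * bext S v w"
  and bext_scale_right: "bilinear S \<Longrightarrow> bext S v (cscale c w) = c * bext S v w"
  by (auto simp: bext_def cscale_def bilinear_ladd bilinear_radd bilinear_lsub bilinear_rsub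
      bilinear_lmul bilinear_rmul complex_eq_iff algebra_simps)

lemma bext_zero_left: "bilinear S \<Longrightarrow> bext S 0 w = 0"
  and bext_zero_right: "bilinear S \<Longrightarrow> bext S w 0 = 0"
  by (auto simp: bext_def bilinear_lzero bilinear_rzero complex_eq_iff)

lemma bext_sum_left: "bilinear S \<Longrightarrow> bext S (sum u A) w = (\<Sum>k\<in>A. bext S (u k) w)"
  by (induction A rule: infinite_finite_induct) (auto simp: bext_add_left bext_zero_left)

lemma bext_sum_right: "bilinear S \<Longrightarrow> bext S w (sum u A) = (\<Sum>k\<in>A. bext S w (u k))"
  by (induction A rule: infinite_finite_induct) (auto simp: bext_add_right bext_zero_right)

lemma bext_isometry:
  assumes "\<And>x y. S (f x) (f y) = S x y"
  shows "bext S (cext f v) (cext f w) = bext S v w"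
  by (simp add: bext_def assms)

lemma bext_infinitesimal_isometry:
  assumes "\<forall>x\<in>U. \<forall>y\<in>U. S (N x) y + S x (N y) = 0" and "v \<in> U \<times> U" "w \<in> U \<times> U"
  shows "bext S (cext N v) w = - bext S v (cext N w)"
proof -
  have "S (N x) y = - S x (N y)" if "x \<in> U" "y \<in> U" for x y
    using assms(1) that by (simp add: eq_neg_iff_add_eq_0)
  thus ?thesis using assms(2,3) by (auto simp: bext_def complex_eq_iff mem_Times_iff)
qed

section \<open>Power series in a nilpotent operator\<close>

text \<open>
Coefficients of formal power series are used in place of arbitrary sequences, so that identities
between operators can be proved in the ring of power series.
\<close>

abbreviation fps_op :: "complex fps \<Rightarrow> ('a::real_vector \<Rightarrow> 'a) \<Rightarrow> 'a \<times> 'a \<Rightarrow> 'a \<times> 'a" where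
  "fps_op f \<equiv> nil_series (fps_nth f)"

lemma nil_series_eq_sum:
  assumes "linear N" and "(cext N ^^ n) v = 0"
  shows "nil_series c N v = (\<Sum>k<n. cscale (c k) ((cext N ^^ k) v))"
proof -
  have "(cext N ^^ k) v = 0" if "k \<ge> n" for k
  proof -
    have "(cext N ^^ k) v = (cext N ^^ (k - n)) ((cext N ^^ n) v)"
      using that by (metis funpow_add comp_apply le_add_diff_inverse2)
    thus ?thesis
      using assms by (simp add: clinear_zero[OF clinear_funpow[OF clinear_cext]])
  qed
  thus ?thesis unfolding nil_series_def
    by (intro sum.mono_neutral_left) (auto intro: leI)
qed

lemma nil_series_mem:
  assumes "cvec.subspace V" and "cext N ` V \<subseteq> V" and "v \<in> V"
  shows "nil_series c N v \<in> V"
  unfolding nil_series_def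
  by (intro cvec.subspace_sum cvec.subspace_scale assms funpow_mem)

lemma clinear_nil_series:
  assumes "linear N" and "\<And>v. (cext N ^^ n) v = 0"
  shows "clinear (nil_series c N)"
proof -
  note L = clinear_funpow[OF clinear_cext[OF assms(1)]]
  show ?thesis
    by (intro clinearI; unfold nil_series_eq_sum[OF assms])
      (simp_all add: clinear_add[OF L] clinear_scale[OF L] cvec.scale_right_distrib sum.distrib
        cvec.scale_sum_right mult.commute)
qed

lemma nil_series_commute:
  assumes "linear N" and "(cext N ^^ n) v = 0" and "clinear T"
    and "\<And>v. T (cext N v) = cext N (T v)"
  shows "T (nil_series c N v) = nil_series c N (T v)"
proof -
  have pow: "T ((cext N ^^ k) v) = (cext N ^^ k) (T v)" for k
    using funpow_commuting[of T "cext N" 1 k v] assms(4) by simp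
  have "(cext N ^^ n) (T v) = 0"
    using pow[of n] assms(2) clinear_zero[OF assms(3)] by simp
  from nil_series_eq_sum[OF assms(1) this] show ?thesis
    by (simp add: nil_series_eq_sum[OF assms(1,2)] clinear_sum[OF assms(3)]
        clinear_scale[OF assms(3)] pow)
qed

lemma funpow_nil_series:
  assumes "linear N" and "(cext N ^^ n) v = 0"
  shows "(cext N ^^ m) (nil_series c N v) = nil_series c N ((cext N ^^ m) v)"
  by (rule nil_series_commute[OF assms clinear_funpow[OF clinear_cext[OF assms(1)]]])
    (metis funpow_swap1)

text \<open>
Separating the constant term exhibits a series in \<open>N\<close> as a scalar plus something in the image of
\<open>N\<close>. Both the invariance of the graded pieces and the sign computation rest on this.
\<close>

lemma nil_series_split:
  assumes "linear N" and "(cext N ^^ n) v = 0"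
  shows "nil_series c N v = cscale (c 0) v + cext N (nil_series (\<lambda>k. c (Suc k)) N v)"
proof -
  note L = clinear_cext[OF assms(1)]
  have "(cext N ^^ Suc n) v = 0" using assms by (simp add: clinear_zero[OF L])
  from nil_series_eq_sum[OF assms(1) this, of c] show ?thesis
    unfolding nil_series_eq_sum[OF assms, of "\<lambda>k. c (Suc k)"]
    by (simp add: sum.lessThan_Suc_shift
        clinear_sum[OF L] clinear_scale[OF L] del: sum.lessThan_Suc)
qed

lemma nil_series_annihilated:
  assumes "linear N" and "cext N v = 0"
  shows "nil_series c N v = cscale (c 0) v"
  using nil_series_eq_sum[OF assms(1), of 1 v c] assms(2) by simp

lemma nil_series_zero: "linear N \<Longrightarrow> nil_series c N 0 = 0"
  using nil_series_eq_sum[of N 0 0 c] by simp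

lemma fps_op_one: "linear N \<Longrightarrow> (cext N ^^ n) v = 0 \<Longrightarrow> fps_op 1 N v = v"
  by (subst nil_series_split) (auto simp: nil_series_def clinear_zero[OF clinear_cext])

text \<open>
The sum over the triangle \<open>i + j < n\<close> that defines the product of the series can be completed to
the square \<open>i, j < n\<close>, since \<open>N\<^bsup>i+j\<^esup>\<close> kills the vector on the added terms.
\<close>

lemma fps_op_mult:
  assumes "linear N" and "(cext N ^^ n) v = 0"
  shows "fps_op (f * g) N v = fps_op f N (fps_op g N v)"
proof -
  note L = clinear_funpow[OF clinear_cext[OF assms(1)]]
  let ?t = "\<lambda>i j. cscale (fps_nth f i * fps_nth g j) ((cext N ^^ (i + j)) v)"
  have big: "(cext N ^^ k) v = 0" if "k \<ge> n" for k
    using that assms(2) by (metis L clinear_zero comp_apply funpow_add le_add_diff_inverse2)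
  hence big': "i + j < n" if "(cext N ^^ (i + j)) v \<noteq> 0" for i j
    using that by (meson not_le)
  have "fps_op (f * g) N v = (\<Sum>k<n. \<Sum>i\<le>k. ?t i (k - i))"
    by (auto simp: nil_series_eq_sum[OF assms] fps_mult_nth cvec.scale_sum_left atLeast0AtMost
        intro!: sum.cong)
  also have "\<dots> = (\<Sum>(i, j)\<in>{(i, j). i + j < n}. ?t i j)"
    by (rule sum.triangle_reindex[symmetric])
  also have "\<dots> = (\<Sum>(i, j)\<in>{..<n} \<times> {..<n}. ?t i j)"
    by (intro sum.mono_neutral_left) (auto dest: big')
  also have "\<dots> = (\<Sum>i<n. \<Sum>j<n. ?t i j)"
    by (simp add: sum.cartesian_product)
  also have "\<dots> = fps_op f N (fps_op g N v)"
  proof -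
    have "(cext N ^^ n) (fps_op g N v) = 0"
      using assms by (simp add: funpow_nil_series nil_series_zero)
    from nil_series_eq_sum[OF assms(1) this] show ?thesis
      by (simp add: nil_series_eq_sum[OF assms] clinear_sum[OF L] clinear_scale[OF L]
        cvec.scale_sum_right funpow_add)
  qed
  finally show ?thesis .
qed

lemma fps_op_diff:
  assumes "linear N" and "(cext N ^^ n) v = 0"
  shows "fps_op (f - g) N v = fps_op f N v - fps_op g N v"
  by (simp add: nil_series_eq_sum[OF assms] cvec.scale_left_diff_distrib sum_subtractf)

lemma fps_op_const:
  assumes "linear N" and "(cext N ^^ n) v = 0"
  shows "fps_op (fps_const c) N v = cscale c v"
  using nil_series_split[OF assms, of "fps_nth (fps_const c)"] 
  by (simp add: nil_series_def clinear_zero[OF clinear_cext[OF assms(1)]])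

lemma fps_op_X:
  assumes "linear N" and "(cext N ^^ n) v = 0"
  shows "fps_op fps_X N v = cext N v"
proof -
  have "(\<lambda>k. fps_nth fps_X (Suc k)) = fps_nth (1 :: complex fps)"
    by (auto simp: fps_X_def)
  thus ?thesis
    using nil_series_split[OF assms, of "fps_nth fps_X"] fps_op_one[OF assms] by simp
qed

lemma funpow_fps_op:
  assumes "linear X" and "(cext X ^^ n) v = 0" and N: "\<And>v. cext N v = fps_op g X v"
  shows "(cext N ^^ i) v = fps_op (g ^ i) X v"
proof (induction i)
  case 0
  show ?case using fps_op_one[OF assms(1,2)] by (simp only: funpow_0 power_0)
next
  case (Suc i)
  thus ?case using fps_op_mult[OF assms(1,2), of g "g ^ i"] N by simp
qed

lemma fps_op_nilpotent:
  assumes "linear X" and "(cext X ^^ n) v = 0" and "fps_nth g 0 = 0"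
    and N: "\<And>v. cext N v = fps_op g X v"
  shows "(cext N ^^ n) v = 0"
  unfolding funpow_fps_op[OF assms(1,2) N] nil_series_eq_sum[OF assms(1,2)]
  using startsby_zero_power_prefix[OF assms(3)] by simp

text \<open>
Here \<open>N = g(X)\<close>. As \<open>g\<close> has no constant term, \<open>g\<^sup>i\<close> starts in degree \<open>i\<close>; only finitely many
\<open>i\<close> contribute and the double sum may be rearranged.
\<close>

lemma fps_op_compose:
  assumes "linear X" "linear N" and "(cext X ^^ n) v = 0"
    and g0: "fps_nth g 0 = 0" and N: "\<And>v. cext N v = fps_op g X v"
  shows "fps_op (f oo g) X v = fps_op f N v"
proof -
  note pow = funpow_fps_op[OF assms(1,3) N] and nil = fps_op_nilpotent[OF assms(1,3) g0 N]
  have prefix: "fps_nth (g ^ i) k = 0" if "k < i" for i k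
    using that startsby_zero_power_prefix[OF g0] by auto
  have "fps_op (f oo g) X v =
      (\<Sum>k<n. \<Sum>i\<le>k. cscale (fps_nth f i * fps_nth (g ^ i) k) ((cext X ^^ k) v))"
    by (simp add: nil_series_eq_sum[OF assms(1,3)] fps_compose_nth cvec.scale_sum_left atLeast0AtMost)
  also have "\<dots> = (\<Sum>k<n. \<Sum>i<n. cscale (fps_nth f i * fps_nth (g ^ i) k) ((cext X ^^ k) v))"
    by (intro sum.cong[OF refl] sum.mono_neutral_left) (auto simp: prefix)
  also have "\<dots> = (\<Sum>i<n. cscale (fps_nth f i) (fps_op (g ^ i) X v))"
    by (subst sum.swap) (simp add: nil_series_eq_sum[OF assms(1,3)] cvec.scale_sum_right)
  also have "\<dots> = fps_op f N v"
    by (simp add: nil_series_eq_sum[OF assms(2) nil] pow)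
  finally show ?thesis .
qed

lemma bext_funpow_adjoint:
  assumes iso: "\<forall>x\<in>U. \<forall>y\<in>U. S (N x) y + S x (N y) = 0"
    and "N ` U \<subseteq> U" and "v \<in> U \<times> U" "w \<in> U \<times> U"
  shows "bext S ((cext N ^^ k) v) w = (-1) ^ k * bext S v ((cext N ^^ k) w)"
  using assms(4)
proof (induction k arbitrary: w)
  case (Suc k)
  have st: "cext N ` (U \<times> U) \<subseteq> U \<times> U" using assms(2) by auto
  have "bext S ((cext N ^^ Suc k) v) w = - bext S ((cext N ^^ k) v) (cext N w)"
    using bext_infinitesimal_isometry[OF iso funpow_mem[OF st assms(3)] Suc.prems] by simp
  also have "\<dots> = - ((-1) ^ k * bext S v ((cext N ^^ k) (cext N w)))"
    using Suc.IH[of "cext N w"] st Suc.prems by (auto simp: image_subset_iff)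
  finally show ?case by (simp add: funpow_swap1)
qed simp

text \<open>
Each of the \<open>k\<close> factors of \<open>N\<^sup>k\<close> changes the sign when it passes to the other argument, which is
the substitution of \<open>-z\<close> for \<open>z\<close> in the series.
\<close>

lemma bext_fps_op_adjoint:
  assumes S: "bilinear S" and iso: "\<forall>x\<in>U. \<forall>y\<in>U. S (N x) y + S x (N y) = 0"
    and U: "N ` U \<subseteq> U" "v \<in> U \<times> U" "w \<in> U \<times> U"
    and nil: "linear N" "(cext N ^^ n) v = 0" "(cext N ^^ n) w = 0"
  shows "bext S (fps_op f N v) w = bext S v (fps_op (f oo - fps_X) N w)"
proof -
  have "fps_nth (f oo - fps_X) k = (-1) ^ k * fps_nth f k" for k
    using fps_nth_compose_linear[of f "-1" k] by (simp add: fps_const_neg[symmetric] del: fps_const_neg)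
  thus ?thesis
    by (simp add: nil_series_eq_sum[OF nil(1,2)] nil_series_eq_sum[OF nil(1,3)] bext_sum_left bext_sum_right S bext_scale_left
        bext_scale_right bext_funpow_adjoint[OF iso U] algebra_simps)
qed

section \<open>Decomposition into eigenspaces\<close>

text \<open>
On the vectors killed by a power of \<open>T - \<zeta>\<close>, the operator \<open>T - z\<close> is the nonzero scalar
\<open>\<zeta> - z\<close> plus a nilpotent operator. Its inverse there is a polynomial in \<open>T\<close> and so preserves every
\<open>T\<close>-stable subspace; the induction avoids writing this polynomial down.
\<close>

lemma mem_if_shifted_mem:
  assumes T: "clinear T" and V: "cvec.subspace V" "T ` V \<subseteq> V" and "\<zeta> \<noteq> z"
    and "((\<lambda>v. T v - cscale \<zeta> v) ^^ k) x = 0" and "((\<lambda>v. T v - cscale z v) ^^ n) x \<in> V"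
  shows "x \<in> V"
proof -
  define D where "D = (\<lambda>z v. T v - cscale z v)"
  have D: "clinear (D z)" for z
    unfolding D_def
    by (intro clinearI) (simp_all add: clinear_add[OF T] clinear_scale[OF T]
        cvec.scale_right_distrib cvec.scale_right_diff_distrib mult.commute)
  have comm: "D z (D z' v) = D z' (D z v)" for z z' v
    unfolding D_def by (simp add: clinear_diff[OF T] clinear_scale[OF T]
        cvec.scale_right_diff_distrib mult.commute)
  have D_V: "D z v \<in> V" if "v \<in> V" for z v
    unfolding D_def using that V by (auto intro!: cvec.subspace_diff cvec.subspace_scale)
  have step: "y \<in> V" if "(D \<zeta> ^^ k) y = 0" "D z y \<in> V" for k y
    using that
  proof (induction k arbitrary: y)
    case 0
    thus ?case using cvec.subspace_0[OF V(1)] by simp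
  next
    case (Suc k)
    have y': "D \<zeta> y \<in> V"
    proof (rule Suc.IH)
      show "(D \<zeta> ^^ k) (D \<zeta> y) = 0" using Suc.prems(1) by (simp add: funpow_swap1)
      show "D z (D \<zeta> y) \<in> V" using D_V[OF Suc.prems(2), of \<zeta>] by (simp add: comm)
    qed
    have "D z y - D \<zeta> y = cscale (\<zeta> - z) y"
      by (simp add: D_def cvec.scale_left_diff_distrib)
    hence "cscale (1 / (\<zeta> - z)) (D z y - D \<zeta> y) = y" using \<open>\<zeta> \<noteq> z\<close> by simp
    moreover have "cscale (1 / (\<zeta> - z)) (D z y - D \<zeta> y) \<in> V"
      by (intro cvec.subspace_scale cvec.subspace_diff V(1) y' Suc.prems(2))
    ultimately show ?case by simp
  qed
  have "(D \<zeta> ^^ k) x = 0 \<Longrightarrow> (D z ^^ n) x \<in> V \<Longrightarrow> x \<in> V"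
  proof (induction n)
    case (Suc n)
    have "(D \<zeta> ^^ k) ((D z ^^ n) x) = 0"
      using Suc.prems(1) by (simp add: funpow_commuting[of "D \<zeta>" "D z", OF comm]
          clinear_zero[OF clinear_funpow[OF D]])
    hence "(D z ^^ n) x \<in> V" by (rule step[of k]) (use Suc.prems(2) in auto)
    thus ?case using Suc by blast
  qed simp
  thus ?thesis using assms(5,6) by (simp add: D_def)
qed

text \<open>
A \<open>T\<close>-stable subspace contains, with any vector, its components in the generalized eigenspaces of
\<open>T\<close>: a power of \<open>T - z\<close> removes the component for \<open>z\<close>, induction handles the others, and the
previous lemma undoes the effect of \<open>T - z\<close> on them. With the zero subspace this is
the linear independence of eigenspaces.
\<close>

lemma stable_subspace_splits:
  assumes T: "clinear T" and V: "cvec.subspace V" "T ` V \<subseteq> V"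
    and "finite A" and "\<And>\<zeta>. \<zeta> \<in> A \<Longrightarrow> \<exists>k. ((\<lambda>v. T v - cscale \<zeta> v) ^^ k) (u \<zeta>) = 0"
    and "sum u A \<in> V" and "\<zeta> \<in> A"
  shows "u \<zeta> \<in> V"
proof -
  define D where "D = (\<lambda>z v. T v - cscale z v)"
  have D: "clinear (D z)" for z
    unfolding D_def
    by (intro clinearI) (simp_all add: clinear_add[OF T] clinear_scale[OF T]
        cvec.scale_right_distrib cvec.scale_right_diff_distrib mult.commute)
  have comm: "D z (D z' v) = D z' (D z v)" for z z' v
    unfolding D_def by (simp add: clinear_diff[OF T] clinear_scale[OF T]
        cvec.scale_right_diff_distrib mult.commute)
  have D_V: "D z ` V \<subseteq> V" for z
    unfolding D_def using V by (auto intro!: cvec.subspace_diff cvec.subspace_scale)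
  have "\<forall>\<zeta>\<in>A. u \<zeta> \<in> V"
    if "\<And>\<zeta>. \<zeta> \<in> A \<Longrightarrow> \<exists>k. (D \<zeta> ^^ k) (u \<zeta>) = 0" "sum u A \<in> V"
    using \<open>finite A\<close> that
  proof (induction A arbitrary: u)
    case (insert z A)
    obtain n where n: "(D z ^^ n) (u z) = 0" using insert.prems(1) by blast
    note Dn = clinear_funpow[OF D, of n z]
    have "(D z ^^ n) (sum u (insert z A)) = (\<Sum>\<zeta>\<in>A. (D z ^^ n) (u \<zeta>))"
      using insert.hyps n by (simp add: clinear_add[OF Dn] clinear_sum[OF Dn])
    hence sum: "(\<Sum>\<zeta>\<in>A. (D z ^^ n) (u \<zeta>)) \<in> V"
      using funpow_mem[OF D_V[of z] insert.prems(2), of n] by simp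
    have "(D z ^^ n) (u \<zeta>) \<in> V" if "\<zeta> \<in> A" for \<zeta>
    proof -
      have "\<exists>k. (D \<zeta> ^^ k) ((D z ^^ n) (u \<zeta>)) = 0" if \<zeta>: "\<zeta> \<in> A" for \<zeta>
      proof -
        obtain k where "(D \<zeta> ^^ k) (u \<zeta>) = 0" using insert.prems(1)[of \<zeta>] \<zeta> by blast
        hence "(D \<zeta> ^^ k) ((D z ^^ n) (u \<zeta>)) = 0"
          by (simp add: funpow_commuting[of "D \<zeta>" "D z", OF comm] clinear_zero[OF Dn])
        thus ?thesis by blast
      qed
      from insert.IH[OF this sum] show ?thesis using that by blast
    qed
    hence mem: "u \<zeta> \<in> V" if "\<zeta> \<in> A" for \<zeta>
      using mem_if_shifted_mem[OF T V, of \<zeta> z] insert.prems(1)[of \<zeta>] insert.hyps(2) that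
      unfolding D_def by blast
    have "sum u (insert z A) - sum u A \<in> V"
      by (intro cvec.subspace_diff cvec.subspace_sum V(1) insert.prems(2) mem)
    thus ?case using mem insert.hyps by simp
  qed simp
  thus ?thesis using assms(5-7) by (simp add: D_def)
qed

lemma csubspace_eigenspace:
  assumes "linear f"
  shows "cvec.subspace (eigenspace f \<zeta>)"
  using clinear_cext[OF assms] by (auto simp: cvec.subspace_def eigenspace_def clinear_zero clinear_add
      clinear_scale cvec.scale_right_distrib mult.commute)

lemma span_eigenspaces_obtain:
  assumes "linear f" and "v \<in> cvec.span (\<Union>\<zeta>\<in>Z. eigenspace f \<zeta>)"
  obtains A u where "finite A" "A \<subseteq> Z" "\<And>\<zeta>. \<zeta> \<in> A \<Longrightarrow> u \<zeta> \<in> eigenspace f \<zeta>" "v = sum u A"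
proof -
  have "\<exists>A u. finite A \<and> A \<subseteq> Z \<and> (\<forall>\<zeta>\<in>A. u \<zeta> \<in> eigenspace f \<zeta>) \<and> v = sum u A"
    using assms(2)
  proof (induction rule: cvec.span_induct_alt)
    case base
    show ?case by (intro exI[of _ "{}"]) auto
  next
    case (step c x y)
    then obtain z A u where z: "z \<in> Z" "x \<in> eigenspace f z" and
      A: "finite A" "A \<subseteq> Z" "\<forall>\<zeta>\<in>A. u \<zeta> \<in> eigenspace f \<zeta>" "y = sum u A" by blast
    define u0 where "u0 = (\<lambda>\<zeta>. if \<zeta> \<in> A then u \<zeta> else 0)"
    define u1 where "u1 = (\<lambda>\<zeta>. u0 \<zeta> + (if \<zeta> = z then cscale c x else 0))"
    have E: "cvec.subspace (eigenspace f \<zeta>)" for \<zeta> by (rule csubspace_eigenspace[OF assms(1)])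
    have "sum u1 (insert z A) = sum u0 (insert z A) + cscale c x"
      unfolding u1_def sum.distrib using A(1) by (simp add: sum.delta)
    also have "sum u0 (insert z A) = sum u A"
      unfolding u0_def using A(1) by (intro sum.mono_neutral_cong_right) auto
    finally have "cscale c x + y = sum u1 (insert z A)" using A(4) by (simp add: add.commute)
    moreover have "\<forall>\<zeta>\<in>insert z A. u1 \<zeta> \<in> eigenspace f \<zeta>"
      using A(3) z(2) unfolding u1_def u0_def
      by (auto intro!: cvec.subspace_add[OF E] cvec.subspace_scale[OF E] cvec.subspace_0[OF E])
    ultimately show ?case using A(1,2) z(1)
      by (intro exI[of _ "insert z A"] exI[of _ u1]) auto
  qed
  thus thesis using that by blast
qed

context
  fixes Ms :: "'a::real_vector \<Rightarrow> 'a"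
  assumes ss: "semisimple Ms"
begin

lemma linear_semisimple: "linear Ms"
  using ss by (simp add: semisimple_def)

lemmas csubspace_eigen = csubspace_eigenspace[OF linear_semisimple]

text \<open>
The decomposition is direct, so that the definite description in the definition of a component
denotes.
\<close>

lemma eigenspace_Int_span_others:
  assumes "x \<in> eigenspace Ms \<zeta>" and "x \<in> cvec.span (\<Union>\<mu>\<in>- {\<zeta>}. eigenspace Ms \<mu>)"
  shows "x = 0"
proof -
  from span_eigenspaces_obtain[OF linear_semisimple assms(2)] obtain A u where
    A: "finite A" "A \<subseteq> - {\<zeta>}" "\<And>\<mu>. \<mu> \<in> A \<Longrightarrow> u \<mu> \<in> eigenspace Ms \<mu>" "x = sum u A" by blast
  define u' where "u' = u(\<zeta> := - x)"
  have "u' \<zeta> \<in> {0}"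
  proof (rule stable_subspace_splits[OF clinear_cext[OF linear_semisimple], of "{0}" "insert \<zeta> A"])
    show "cext Ms ` {0} \<subseteq> {0}" by (simp add: clinear_zero[OF clinear_cext[OF linear_semisimple]])
    have "sum u' A = sum u A" using A(2) unfolding u'_def by (intro sum.cong) auto
    moreover have "\<zeta> \<notin> A" using A(2) by auto
    ultimately show "sum u' (insert \<zeta> A) \<in> {0}"
      using A(1,4) by (simp add: u'_def)
    fix \<mu> assume "\<mu> \<in> insert \<zeta> A"
    hence "u' \<mu> \<in> eigenspace Ms \<mu>"
      using A(3) assms(1) cvec.subspace_neg[OF csubspace_eigen] by (auto simp: u'_def)
    thus "\<exists>k. ((\<lambda>v. cext Ms v - cscale \<mu> v) ^^ k) (u' \<mu>) = 0"
      by (intro exI[of _ 1]) (auto simp: eigenspace_def)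
  qed (use A(1) in auto)
  thus ?thesis by (simp add: u'_def)
qed

lemma component_eqI:
  assumes "x \<in> eigenspace Ms \<zeta>" "v - x \<in> cvec.span (\<Union>\<mu>\<in>- {\<zeta>}. eigenspace Ms \<mu>)"
  shows "component Ms \<zeta> v = x"
  unfolding component_def
proof (rule the_equality)
  fix y assume y: "y \<in> eigenspace Ms \<zeta> \<and> v - y \<in> cvec.span (\<Union>\<mu>\<in>- {\<zeta>}. eigenspace Ms \<mu>)"
  have "y - x \<in> eigenspace Ms \<zeta>" using y assms(1) cvec.subspace_diff[OF csubspace_eigen] by blast
  moreover have "y - x = (v - x) - (v - y)" by simp
  hence "y - x \<in> cvec.span (\<Union>\<mu>\<in>- {\<zeta>}. eigenspace Ms \<mu>)" using y assms(2) cvec.span_diff by metis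
  ultimately show "y = x" using eigenspace_Int_span_others by fastforce
qed (use assms in blast)

lemma component_sum:
  assumes "finite A" "\<And>\<mu>. \<mu> \<in> A \<Longrightarrow> u \<mu> \<in> eigenspace Ms \<mu>"
  shows "component Ms \<zeta> (sum u A) = (if \<zeta> \<in> A then u \<zeta> else 0)"
proof (rule component_eqI)
  have "sum u A - (if \<zeta> \<in> A then u \<zeta> else 0) = sum u (A - {\<zeta>})"
    using assms(1) by (auto simp: sum_diff1)
  also have "\<dots> \<in> cvec.span (\<Union>\<mu>\<in>- {\<zeta>}. eigenspace Ms \<mu>)"
    using assms(2) by (intro cvec.span_sum cvec.span_base) auto
  finally show "sum u A - (if \<zeta> \<in> A then u \<zeta> else 0) \<in> cvec.span (\<Union>\<mu>\<in>- {\<zeta>}. eigenspace Ms \<mu>)" .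
qed (use assms(2) cvec.subspace_0[OF csubspace_eigen] in auto)

lemma eigen_sum_obtain:
  obtains A u where "finite A" "\<And>\<zeta>. \<zeta> \<in> A \<Longrightarrow> u \<zeta> \<in> eigenspace Ms \<zeta>" "v = sum u A"
proof -
  have "v \<in> cvec.span (\<Union>\<zeta>\<in>UNIV. eigenspace Ms \<zeta>)" using ss by (simp add: semisimple_def)
  from span_eigenspaces_obtain[OF linear_semisimple this] that show thesis by metis
qed

lemma component_eigenspace:
  "v \<in> eigenspace Ms \<mu> \<Longrightarrow> component Ms \<zeta> v = (if \<zeta> = \<mu> then v else 0)"
  using component_sum[of "{\<mu>}" "\<lambda>_. v" \<zeta>] by simp

lemma component_mem_eigenspace: "component Ms \<zeta> v \<in> eigenspace Ms \<zeta>"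
proof -
  obtain A u where "finite A" "\<And>\<zeta>. \<zeta> \<in> A \<Longrightarrow> u \<zeta> \<in> eigenspace Ms \<zeta>" "v = sum u A"
    using eigen_sum_obtain by blast
  thus ?thesis using cvec.subspace_0[OF csubspace_eigen] by (simp add: component_sum)
qed

lemma component_component: "component Ms \<zeta> (component Ms \<zeta> v) = component Ms \<zeta> v"
  using component_eigenspace[OF component_mem_eigenspace] by simp

lemma finite_components: "finite {\<zeta>. component Ms \<zeta> v \<noteq> 0}"
  and sum_components: "(\<Sum>\<zeta>\<in>{\<zeta>. component Ms \<zeta> v \<noteq> 0}. component Ms \<zeta> v) = v"
proof -
  obtain A u where A: "finite A" "\<And>\<zeta>. \<zeta> \<in> A \<Longrightarrow> u \<zeta> \<in> eigenspace Ms \<zeta>" "v = sum u A"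
    using eigen_sum_obtain by blast
  hence c: "component Ms \<zeta> v = (if \<zeta> \<in> A then u \<zeta> else 0)" for \<zeta> by (simp add: component_sum)
  thus "finite {\<zeta>. component Ms \<zeta> v \<noteq> 0}"
    by (auto intro: finite_subset[OF _ A(1)] split: if_splits)
  have "(\<Sum>\<zeta>\<in>{\<zeta>. component Ms \<zeta> v \<noteq> 0}. component Ms \<zeta> v) = sum u A"
    using A(1) by (intro sum.mono_neutral_cong_left) (auto simp: c)
  thus "(\<Sum>\<zeta>\<in>{\<zeta>. component Ms \<zeta> v \<noteq> 0}. component Ms \<zeta> v) = v" using A(3) by simp
qed

lemma diff_component_mem_span:
  "v - component Ms \<zeta> v \<in> cvec.span (\<Union>\<mu>\<in>- {\<zeta>}. eigenspace Ms \<mu>)"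
proof -
  have "v - component Ms \<zeta> v = (\<Sum>\<mu>\<in>{\<mu>. component Ms \<mu> v \<noteq> 0} - {\<zeta>}. component Ms \<mu> v)"
    using sum_components[of v] finite_components[of v] by (auto simp: sum_diff1)
  also have "\<dots> \<in> cvec.span (\<Union>\<mu>\<in>- {\<zeta>}. eigenspace Ms \<mu>)"
    by (intro cvec.span_sum cvec.span_base) (use component_mem_eigenspace in blast)
  finally show ?thesis .
qed

lemma clinear_component: "clinear (component Ms \<zeta>)"
proof (rule clinearI)
  note E = component_mem_eigenspace and R = diff_component_mem_span
  show "component Ms \<zeta> (v + w) = component Ms \<zeta> v + component Ms \<zeta> w" for v w
    using cvec.subspace_add[OF csubspace_eigen E E, of \<zeta> v w] cvec.span_add[OF R R, of v \<zeta> w]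
    by (intro component_eqI) (simp_all add: algebra_simps)
  show "component Ms \<zeta> (cscale c v) = cscale c (component Ms \<zeta> v)" for c v
    using cvec.subspace_scale[OF csubspace_eigen E] cvec.span_scale[OF R, of c v \<zeta>]
    by (intro component_eqI) (simp_all add: cvec.scale_right_diff_distrib)
qed

lemma component_commute:
  assumes "clinear T" and "\<And>\<mu> v. v \<in> eigenspace Ms \<mu> \<Longrightarrow> T v \<in> eigenspace Ms \<mu>"
  shows "component Ms \<zeta> (T v) = T (component Ms \<zeta> v)"
proof -
  obtain A u where A: "finite A" "\<And>\<zeta>. \<zeta> \<in> A \<Longrightarrow> u \<zeta> \<in> eigenspace Ms \<zeta>" "v = sum u A"
    using eigen_sum_obtain by blast
  thus ?thesis using component_sum[of A "\<lambda>\<mu>. T (u \<mu>)"] assms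
    by (auto simp: component_sum clinear_sum clinear_zero)
qed

lemma cconj_mem_eigenspace: "v \<in> eigenspace Ms \<mu> \<Longrightarrow> cconj v \<in> eigenspace Ms (cnj \<mu>)"
  by (simp add: eigenspace_def cext_cconj[OF linear_semisimple])

lemma component_cconj: "component Ms \<zeta> (cconj v) = cconj (component Ms (cnj \<zeta>) v)"
proof -
  obtain A u where A: "finite A" "\<And>\<zeta>. \<zeta> \<in> A \<Longrightarrow> u \<zeta> \<in> eigenspace Ms \<zeta>" "v = sum u A"
    using eigen_sum_obtain by blast
  have "cconj v = (\<Sum>\<mu>\<in>cnj ` A. cconj (u (cnj \<mu>)))"
    unfolding A(3) cconj_sum by (subst sum.reindex) (auto simp: inj_on_def)
  moreover have "cconj (u (cnj \<mu>)) \<in> eigenspace Ms \<mu>" if "\<mu> \<in> cnj ` A" for \<mu>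
    using cconj_mem_eigenspace[of "u (cnj \<mu>)" "cnj \<mu>"] A(2) that by auto
  moreover have "\<zeta> \<in> cnj ` A \<longleftrightarrow> cnj \<zeta> \<in> A"
    by (metis complex_cnj_cnj image_iff)
  ultimately show ?thesis
    using component_sum[of "cnj ` A" "\<lambda>\<mu>. cconj (u (cnj \<mu>))" \<zeta>] A by (simp add: component_sum)
qed

text \<open>
This is applied with \<open>T = M\<^sub>s\<close> to the Hodge filtration and with \<open>T = M\<close> to the weight filtration;
in the second case the eigenspaces of \<open>M\<^sub>s\<close> are only generalized eigenspaces of \<open>T\<close>.
\<close>

lemma component_mem_stable:
  assumes T: "clinear T" and V: "cvec.subspace V" "T ` V \<subseteq> V" and "v \<in> V"
    and nil: "\<And>\<mu> v. v \<in> eigenspace Ms \<mu> \<Longrightarrow> \<exists>k. ((\<lambda>w. T w - cscale \<mu> w) ^^ k) v = 0"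
  shows "component Ms \<zeta> v \<in> V"
proof (cases "component Ms \<zeta> v = 0")
  case True
  thus ?thesis using cvec.subspace_0[OF V(1)] by simp
next
  case False
  show ?thesis
    by (rule stable_subspace_splits[OF T V finite_components[of v]])
      (use nil component_mem_eigenspace False \<open>v \<in> V\<close> in \<open>auto simp: sum_components\<close>)
qed

lemma mem_if_components_mem:
  assumes "cvec.subspace V" and "\<And>\<zeta>. component Ms \<zeta> v \<in> V"
  shows "v \<in> V"
  using cvec.subspace_sum[OF assms(1), of "{\<zeta>. component Ms \<zeta> v \<noteq> 0}" "\<lambda>\<zeta>. component Ms \<zeta> v"]
    assms(2) sum_components by metis

lemma eq_if_components_eq:
  assumes "\<And>\<zeta>. component Ms \<zeta> v = component Ms \<zeta> w"
  shows "v = w"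
proof -
  have "(\<Sum>\<zeta>\<in>{\<zeta>. component Ms \<zeta> v \<noteq> 0}. component Ms \<zeta> v) =
      (\<Sum>\<zeta>\<in>{\<zeta>. component Ms \<zeta> w \<noteq> 0}. component Ms \<zeta> w)"
    by (simp only: assms)
  thus ?thesis by (simp only: sum_components)
qed

lemma H_ne1_iff: "v \<in> H_ne1 Ms \<longleftrightarrow> component Ms 1 v = 0"
proof
  assume "v \<in> H_ne1 Ms"
  thus "component Ms 1 v = 0"
    using component_eqI[of 0 1 v] cvec.subspace_0[OF csubspace_eigen] by (simp add: H_ne1_def)
qed (use diff_component_mem_span[of v 1] in \<open>simp add: H_ne1_def\<close>)

lemma eigenspace_subset_H_ne1: "\<zeta> \<noteq> 1 \<Longrightarrow> v \<in> eigenspace Ms \<zeta> \<Longrightarrow> v \<in> H_ne1 Ms"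
  by (simp add: H_ne1_iff component_eigenspace)

lemma csubspace_H_ne1: "cvec.subspace (H_ne1 Ms)"
  by (simp add: H_ne1_def)

end

text \<open>
Real and imaginary parts are \<open>(v + cnj v)/2\<close> and \<open>(v - cnj v)/2i\<close>, which stay in a complex subspace
that is stable under conjugation.
\<close>

lemma real_points_complexification:
  assumes V: "cvec.subspace V" and conj: "\<And>v. v \<in> V \<Longrightarrow> cconj v \<in> V"
  shows "real_points V \<times> real_points V = V" and "subspace (real_points V)"
proof -
  have real_parts: "(x, 0) \<in> V \<and> (y, 0) \<in> V" if v: "(x, y) \<in> V" for x y
  proof -
    have "cscale (1/2) ((x, y) + cconj (x, y)) \<in> V" "cscale (- \<i> / 2) ((x, y) - cconj (x, y)) \<in> V"
      by (rule cvec.subspace_scale[OF V] cvec.subspace_add[OF V] cvec.subspace_diff[OF V]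
          conj[OF v] v)+
    moreover have "cscale (1/2) ((x, y) + cconj (x, y)) = (x, 0)"
      "cscale (- \<i> / 2) ((x, y) - cconj (x, y)) = (y, 0)"
      by (simp_all add: cscale_def cconj_def)
    ultimately show ?thesis by simp
  qed
  have of_real_parts: "(x, y) \<in> V" if "(x, 0) \<in> V" "(y, 0) \<in> V" for x y
  proof -
    have "(x, 0) + cscale \<i> (y, 0) \<in> V" using that V by (intro cvec.subspace_add cvec.subspace_scale)
    thus ?thesis by (simp add: cscale_def)
  qed
  have "p \<in> V \<longleftrightarrow> (fst p, 0) \<in> V \<and> (snd p, 0) \<in> V" for p
    using real_parts[of "fst p" "snd p"] of_real_parts[of "fst p" "snd p"] by auto
  thus "real_points V \<times> real_points V = V"
    unfolding real_points_def set_eq_iff mem_Times_iff mem_Collect_eq by blast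
  show "subspace (real_points V)"
  proof (rule subspaceI)
    show "0 \<in> real_points V"
      using cvec.subspace_0[OF V] by (simp add: real_points_def zero_prod_def)
    show "x + y \<in> real_points V" if "x \<in> real_points V" "y \<in> real_points V" for x y
      using cvec.subspace_add[OF V, of "(x, 0)" "(y, 0)"] that by (simp add: real_points_def)
    show "c *\<^sub>R x \<in> real_points V" if "x \<in> real_points V" for c x
      using cvec.subspace_scale[OF V, of "(x, 0)" "of_real c"] that
      by (simp add: real_points_def cscale_def)
  qed
qed

lemma real_points_H_ne1:
  assumes "semisimple Ms"
  shows "Hne1_real Ms \<times> Hne1_real Ms = H_ne1 Ms" and "subspace (Hne1_real Ms)"
  by (rule real_points_complexification[OF csubspace_H_ne1[OF assms]];
      simp add: H_ne1_iff[OF assms] component_cconj[OF assms])+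

lemma real_points_eigenspace_one:
  assumes "semisimple Ms"
  shows "H1_real Ms \<times> H1_real Ms = eigenspace Ms 1" and "subspace (H1_real Ms)"
  by (rule real_points_complexification[OF csubspace_eigen[OF assms]];
      use cconj_mem_eigenspace[OF assms] in force)+

section \<open>The reflection formula as an identity of power series\<close>

text \<open>
The Taylor series at 0 of \<open>z \<mapsto> \<Gamma>(\<alpha> - z/2\<pi>i)\<close>.
\<close>

definition gamma_fps :: "real \<Rightarrow> complex fps" where
  "gamma_fps \<alpha> = Abs_fps (\<lambda>k. 1 / fact k * (deriv ^^ k) Gamma (complex_of_real \<alpha>) * (- 1 / (2 * pi * \<i>)) ^ k)"

lemma G_alpha_eq_fps_op: "G_alpha N \<alpha> = fps_op (gamma_fps \<alpha>) N"
proof -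
  have "fps_nth (gamma_fps \<alpha>) =
      (\<lambda>k. 1 / fact k * (deriv ^^ k) Gamma (complex_of_real \<alpha>) * (- 1 / (2 * pi * \<i>)) ^ k)"
    by (auto simp: gamma_fps_def)
  thus ?thesis by (simp only: G_alpha_def)
qed

lemma gamma_fps_nth_0: "fps_nth (gamma_fps \<alpha>) 0 = Gamma (complex_of_real \<alpha>)"
  by (simp add: gamma_fps_def)

lemma has_fps_expansion_gamma_fps:
  assumes "\<alpha> > 0"
  shows "(\<lambda>z. Gamma (complex_of_real \<alpha> - z / (2 * pi * \<i>))) has_fps_expansion gamma_fps \<alpha>"
proof -
  let ?a = "complex_of_real \<alpha>" and ?c = "- 1 / (2 * pi * \<i>) :: complex"
  have "w \<notin> \<int>\<^sub>\<le>\<^sub>0" if "dist ?a w < \<alpha>" for w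
  proof -
    have "Re w > 0" using that abs_Re_le_cmod[of "?a - w"] by (simp add: dist_norm)
    thus ?thesis by (auto elim!: nonpos_Ints_cases)
  qed
  hence holo: "Gamma holomorphic_on eball ?a (ereal \<alpha>)"
    by (intro holomorphic_Gamma) (auto simp: in_eball_iff)
  have "ereal \<alpha> \<le> fps_conv_radius (fps_expansion Gamma ?a)"
    by (rule conv_radius_fps_expansion[OF holo])
  hence "fps_conv_radius (fps_expansion Gamma ?a) > 0"
    using assms by (metis ereal_less(2) less_le_trans)
  moreover have "eventually (\<lambda>w. w \<in> ball 0 \<alpha>) (nhds (0::complex))"
    using assms by (intro eventually_nhds_in_open) auto
  hence "eventually (\<lambda>w. eval_fps (fps_expansion Gamma ?a) w = Gamma (?a + w)) (nhds 0)"
    by eventually_elim (use eval_fps_expansion'[OF holo] in auto)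
  ultimately have exp: "(\<lambda>w. Gamma (?a + w)) has_fps_expansion fps_expansion Gamma ?a"
    by (simp add: has_fps_expansion_def)
  have lin: "(\<lambda>z. ?c * z) has_fps_expansion fps_const ?c * fps_X"
    by (intro fps_expansion_intros)
  have "((\<lambda>w. Gamma (?a + w)) \<circ> (\<lambda>z. ?c * z)) has_fps_expansion
      (fps_expansion Gamma ?a oo (fps_const ?c * fps_X))"
    by (rule has_fps_expansion_compose[OF exp lin]) simp
  moreover have "fps_expansion Gamma ?a oo (fps_const ?c * fps_X) = gamma_fps \<alpha>"
    by (rule fps_ext) (simp add: gamma_fps_def fps_expansion_def)
  ultimately show ?thesis by (simp add: o_def)
qed

lemma has_fps_expansion_gamma_fps_uminus:
  assumes "\<alpha> > 0"
  shows "(\<lambda>z. Gamma (complex_of_real \<alpha> + z / (2 * pi * \<i>))) has_fps_expansion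
    (gamma_fps \<alpha> oo - fps_X)"
proof -
  have "((\<lambda>z. Gamma (complex_of_real \<alpha> - z / (2 * pi * \<i>))) \<circ> (\<lambda>z. - z)) has_fps_expansion
    (gamma_fps \<alpha> oo - fps_X)"
    by (intro has_fps_expansion_compose has_fps_expansion_gamma_fps assms fps_expansion_intros) simp
  thus ?thesis by (simp add: o_def)
qed

lemma sin_two_i: "exp (\<i> * w) - exp (- (\<i> * w)) = 2 * \<i> * sin (w :: complex)"
  by (simp add: sin_exp_eq)

text \<open>
With \<open>x = \<alpha> + z/2\<pi>i\<close> the factors on the left expand \<open>\<Gamma>(x)\<close>, \<open>exp(2\<pi>i\<alpha>) exp(z) - 1\<close>,
\<open>exp(-z/2)\<close> and \<open>\<Gamma>(1 - x)\<close>. Since \<open>2\<pi>i\<alpha> + z = 2\<pi>ix\<close>, the two middle ones multiply to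
\<open>2i exp(\<pi>i\<alpha>) sin(\<pi>x)\<close>, which cancels the sine in the reflection formula.
\<close>

lemma gamma_fps_reflection:
  assumes "0 < \<alpha>" "\<alpha> < 1"
  shows "(gamma_fps \<alpha> oo - fps_X) *
      ((fps_const (exp (2 * of_real pi * \<i> * of_real \<alpha>)) * fps_exp 1 - 1) * (fps_exp (- 1 / 2) * gamma_fps (1 - \<alpha>)))
    = fps_const (2 * of_real pi * \<i> * exp (of_real pi * \<i> * of_real \<alpha>))"
proof (rule fps_expansion_unique_complex)
  let ?x = "\<lambda>z::complex. of_real \<alpha> + z / (2 * pi * \<i>)"
  let ?f = "\<lambda>z. Gamma (?x z) * ((exp (2 * of_real pi * \<i> * of_real \<alpha>) * exp (1 * z) - 1) *
    (exp (- 1 / 2 * z) * Gamma (complex_of_real (1 - \<alpha>) - z / (2 * pi * \<i>))))"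
  show "?f has_fps_expansion (gamma_fps \<alpha> oo - fps_X) *
      ((fps_const (exp (2 * of_real pi * \<i> * of_real \<alpha>)) * fps_exp 1 - 1) * (fps_exp (- 1 / 2) * gamma_fps (1 - \<alpha>)))"
    by (intro has_fps_expansion_mult has_fps_expansion_diff has_fps_expansion_cmult_left
        has_fps_expansion_exp has_fps_expansion_1 has_fps_expansion_gamma_fps
        has_fps_expansion_gamma_fps_uminus) (use assms in auto)
  have "isCont (\<lambda>z. sin (of_real pi * ?x z)) 0"
    by (intro continuous_intros) auto
  hence "((\<lambda>z. sin (of_real pi * ?x z)) \<longlongrightarrow> sin (of_real pi * ?x 0)) (nhds 0)"
    using tendsto_at_iff_tendsto_nhds[of "\<lambda>z. sin (of_real pi * ?x z)" 0] by (simp only: isCont_def)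
  hence "((\<lambda>z. sin (of_real pi * ?x z)) \<longlongrightarrow> sin (of_real pi * of_real \<alpha>)) (nhds 0)"
    by (simp only: div_0 add_0_right)
  moreover have "sin (of_real pi * complex_of_real \<alpha>) = of_real (sin (pi * \<alpha>))"
    by (simp flip: sin_of_real of_real_mult)
  moreover have "sin (pi * \<alpha>) \<noteq> 0"
    using sin_gt_zero[of "pi * \<alpha>"] assms by simp
  ultimately have "eventually (\<lambda>z. sin (of_real pi * ?x z) \<noteq> 0) (nhds 0)"
    by (intro tendsto_imp_eventually_ne) auto
  hence "eventually (\<lambda>z. ?f z = 2 * of_real pi * \<i> * exp (of_real pi * \<i> * of_real \<alpha>)) (nhds 0)"
  proof eventually_elim
    case (elim z)
    have pz: "\<i> * (of_real pi * ?x z) = of_real pi * \<i> * of_real \<alpha> + z / 2"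
      by (simp add: field_simps)
    have "exp (2 * of_real pi * \<i> * of_real \<alpha>) * exp (1 * z) - 1 =
        exp (of_real pi * \<i> * of_real \<alpha>) * exp (z / 2) * (exp (\<i> * (of_real pi * ?x z)) - exp (- (\<i> * (of_real pi * ?x z))))"
      unfolding pz by (simp add: right_diff_distrib mult_ac add_ac flip: exp_add)
    hence "?f z = Gamma (?x z) * Gamma (1 - ?x z) * exp (of_real pi * \<i> * of_real \<alpha>) * (exp (z / 2) * exp (- (z / 2)))
        * (2 * \<i> * sin (of_real pi * ?x z))"
      unfolding sin_two_i by (simp add: algebra_simps)
    also have "exp (z / 2) * exp (- (z / 2)) = 1" by (simp flip: exp_add)
    also have "Gamma (?x z) * Gamma (1 - ?x z) = of_real pi / sin (of_real pi * ?x z)"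
      by (rule Gamma_reflection_complex)
    finally show ?case using elim by simp
  qed
  thus "?f has_fps_expansion fps_const (2 * of_real pi * \<i> * exp (of_real pi * \<i> * of_real \<alpha>))"
    by (subst has_fps_expansion_cong[OF _ refl]) auto
qed

text \<open>
With \<open>u = z/2\<pi>i\<close> the product, multiplied by \<open>z\<close>, is
\<open>\<Gamma>(1 + u) \<Gamma>(1 - u) 2i sin(\<pi>u) = 2\<pi>iu = z\<close>. The factor \<open>z\<close> is cancelled in the ring of power
series, where it is not a zero divisor.
\<close>

lemma gamma_fps_reflection_one:
  "(gamma_fps 1 oo - fps_X) * (Abs_fps (\<lambda>k. 1 / fact (k + 1)) * (fps_exp (- 1 / 2) * gamma_fps 1)) = 1"
proof -
  let ?E = "Abs_fps (\<lambda>k. 1 / fact (k + 1) :: complex)"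
  let ?u = "\<lambda>z::complex. z / (2 * pi * \<i>)"
  let ?f = "\<lambda>z. Gamma (complex_of_real 1 + ?u z) * ((exp (1 * z) - 1) *
    (exp (- 1 / 2 * z) * Gamma (complex_of_real 1 - ?u z)))"
  have "(gamma_fps 1 oo - fps_X) * ((fps_exp 1 - 1) * (fps_exp (- 1 / 2) * gamma_fps 1)) = fps_X"
  proof (rule fps_expansion_unique_complex)
    show "?f has_fps_expansion
        (gamma_fps 1 oo - fps_X) * ((fps_exp 1 - 1) * (fps_exp (- 1 / 2) * gamma_fps 1))"
      by (intro has_fps_expansion_mult has_fps_expansion_diff
        has_fps_expansion_exp has_fps_expansion_1 has_fps_expansion_gamma_fps
        has_fps_expansion_gamma_fps_uminus) auto
    have "eventually (\<lambda>z. z \<in> ball 0 1) (nhds (0::complex))"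
      by (intro eventually_nhds_in_open) auto
    hence "eventually (\<lambda>z. ?f z = z) (nhds 0)"
    proof eventually_elim
      case (elim z)
      show ?case
      proof (cases "z = 0")
        case False
        define u where "u = ?u z"
        have z: "z = 2 * pi * \<i> * u" by (simp add: u_def)
        have "norm u < 1" "u \<noteq> 0"
          using elim False pi_gt3 by (auto simp: u_def norm_divide norm_mult divide_less_eq)
        hence "u \<notin> \<int>"
          by (auto elim!: Ints_cases)
        hence sin: "sin (of_real pi * u) \<noteq> 0"
          using sin_eq_0[of "of_real pi * u"] by (auto simp: mult.commute)
        have "u \<notin> \<int>\<^sub>\<le>\<^sub>0" using \<open>u \<notin> \<int>\<close> nonpos_Ints_Int by blast
        hence G: "Gamma (1 + u) = u * Gamma u" using Gamma_plus1[of u] by (simp add: add.commute)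
        have pz: "\<i> * (of_real pi * u) = z / 2" by (simp add: z)
        have "exp (1 * z) - 1 = exp (z / 2) * (exp (\<i> * (of_real pi * u)) - exp (- (\<i> * (of_real pi * u))))"
          unfolding pz by (simp add: right_diff_distrib flip: exp_add)
        hence "?f z = u * (Gamma u * Gamma (1 - u)) * (exp (z / 2) * exp (- (z / 2)))
            * (2 * \<i> * sin (of_real pi * u))"
          unfolding sin_two_i u_def[symmetric] by (simp add: G algebra_simps)
        also have "exp (z / 2) * exp (- (z / 2)) = 1" by (simp flip: exp_add)
        also have "Gamma u * Gamma (1 - u) = of_real pi / sin (of_real pi * u)"
          by (rule Gamma_reflection_complex)
        finally show ?thesis using sin by (simp add: z)
      qed simp
    qed
    thus "?f has_fps_expansion fps_X"
      by (subst has_fps_expansion_cong[OF _ refl]) (auto intro: has_fps_expansion_fps_X)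
  qed
  also have "fps_exp 1 - 1 = fps_X * ?E"
    by (rule fps_ext) (auto simp: fps_X_mult_nth gr0_conv_Suc)
  finally have "fps_X * ((gamma_fps 1 oo - fps_X) * (?E * (fps_exp (- 1 / 2) * gamma_fps 1))) = fps_X * 1"
    by (simp add: algebra_simps)
  thus ?thesis unfolding mult_cancel_left by simp
qed

section \<open>Mixed Hodge structures\<close>

lemma incr_filtrationD:
  assumes "incr_filtration U W"
  shows "j \<le> k \<Longrightarrow> cW W j \<subseteq> cW W k" and "subspace (W k)" and "cvec.subspace (cW W k)"
    and "\<exists>k. cW W k = {0}" and "\<exists>k. cW W k = U \<times> U"
proof -
  have "mono W" and sub: "\<And>k. subspace (W k)" using assms by (auto simp: incr_filtration_def)
  thus "subspace (W k)" "cvec.subspace (cW W k)" by (auto intro: subspace_complexification)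
  show "cW W j \<subseteq> cW W k" if "j \<le> k" using monoD[OF \<open>mono W\<close> that] by auto
  obtain k where "W k = {0}" using assms unfolding incr_filtration_def by auto
  hence "cW W k = {0}" by (auto simp: zero_prod_def)
  thus "\<exists>k. cW W k = {0}" by blast
  show "\<exists>k. cW W k = U \<times> U" using assms unfolding incr_filtration_def by auto
qed

lemma csubspace_F_Gr:
  assumes "cvec.subspace (F p)" "cvec.subspace (cW W k)" "cvec.subspace (cW W (k - 1))"
  shows "cvec.subspace (F_Gr F W p k)"
  unfolding F_Gr_def by (intro csubspace_set_plus cvec.subspace_inter assms)

lemma mem_F_GrI:
  assumes "v \<in> F p" "v \<in> cW W k" "w \<in> cW W (k - 1)"
  shows "v + w \<in> F_Gr F W p k"
  unfolding F_Gr_def using assms by blast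

lemma F_Gr_cases:
  assumes "v \<in> F_Gr F W p k"
  obtains x y where "v = x + y" "x \<in> F p" "x \<in> cW W k" "y \<in> cW W (k - 1)"
  using assms unfolding F_Gr_def by (auto elim!: set_plus_elim)

lemma F_GrI1: "v \<in> F p \<Longrightarrow> v \<in> cW W k \<Longrightarrow> subspace (W (k - 1)) \<Longrightarrow> v \<in> F_Gr F W p k"
  using mem_F_GrI[of v F p W k 0] by (simp add: subspace_0 mem_Times_iff)

lemma F_GrI2: "v \<in> cW W (k - 1) \<Longrightarrow> 0 \<in> F p \<Longrightarrow> subspace (W k) \<Longrightarrow> v \<in> F_Gr F W p k"
  using mem_F_GrI[of 0 F p W k v] by (simp add: subspace_0 mem_Times_iff)

text \<open>
Modulo weight \<open>p + q - n - 1\<close> only the summands with \<open>j < n\<close> of the defining sum survive, and all of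
those lie in the conjugate of \<open>F\<^bsup>q-n+1\<^esup>\<close>.
\<close>

lemma Deligne_I_mod_lower:
  assumes "MHS U F W" and a: "a \<in> Deligne_I F W p q" and "n \<ge> 1"
  shows "a \<in> cconj ` F (q - n + 1) + cW W (p + q - n - 1)"
proof -
  have incr: "incr_filtration U W" and F: "antimono F" "\<And>p. cvec.subspace (F p)"
    using assms(1) by (auto simp: MHS_def decr_filtration_def)
  note cW = incr_filtrationD(1,3)[OF incr]
  have F_mono: "cconj ` F j \<subseteq> cconj ` F k" if "k \<le> j" for j k
    using antimonoD[OF F(1) that] by blast
  let ?V = "cconj ` F (q - n + 1) + cW W (p + q - n - 1)"
  have V: "cvec.subspace ?V"
    by (intro csubspace_set_plus csubspace_cconj F(2) cW(2))
  have left: "cconj ` F (q - n + 1) \<subseteq> ?V"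
    using set_plus_intro[OF _ cvec.subspace_0[OF cW(2)]] by (metis add_0_right subsetI)
  have right: "cW W (p + q - n - 1) \<subseteq> ?V"
    using set_plus_intro[OF cvec.subspace_0[OF csubspace_cconj[OF F(2)]]] by (metis add_0_left subsetI)
  have "cconj ` F (q - j) \<inter> cW W (p + q - j - 1) \<subseteq> ?V" if "j > 0" for j
  proof (cases "j < n")
    case True
    hence "cconj ` F (q - j) \<subseteq> cconj ` F (q - n + 1)" by (intro F_mono) simp
    thus ?thesis by (intro le_infI1 order_trans[OF _ left])
  next
    case False
    hence "cW W (p + q - j - 1) \<subseteq> cW W (p + q - n - 1)" by (intro cW(1)) simp
    thus ?thesis by (intro le_infI2 order_trans[OF _ right])
  qed
  hence span: "cvec.span (\<Union>j\<in>{0<..}. cconj ` F (q - j) \<inter> cW W (p + q - j - 1)) \<subseteq> ?V"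
    by (intro cvec.span_minimal[OF _ V] UN_least) simp
  have first: "cconj ` F q \<inter> cW W (p + q) \<subseteq> ?V"
  proof -
    have "cconj ` F q \<subseteq> cconj ` F (q - n + 1)" using \<open>n \<ge> 1\<close> by (intro F_mono) simp
    thus ?thesis by (intro le_infI1 order_trans[OF _ left])
  qed
  have "a \<in> cconj ` F q \<inter> cW W (p + q) +
      cvec.span (\<Union>j\<in>{0<..}. cconj ` F (q - j) \<inter> cW W (p + q - j - 1))"
    using a by (simp only: Deligne_I_def Int_iff)
  then obtain x y where a: "a = x + y" and x: "x \<in> cconj ` F q \<inter> cW W (p + q)"
    and y: "y \<in> cvec.span (\<Union>j\<in>{0<..}. cconj ` F (q - j) \<inter> cW W (p + q - j - 1))"
    by (rule set_plus_elim)
  show ?thesis unfolding a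
    by (rule cvec.subspace_add[OF V subsetD[OF first x] subsetD[OF span y]])
qed

text \<open>
Suppose that the element has weight at most \<open>k = p + q - n\<close> with \<open>n \<ge> 1\<close>. Its class in weight \<open>k\<close>
lies in \<open>F\<^sup>p\<close> and, by the previous lemma, in the conjugate of \<open>F\<^bsup>k+1-p\<^esup>\<close>; purity makes the class
vanish, so the weight drops further until it reaches the zero subspace.
\<close>

lemma Deligne_I_Int_lower:
  assumes "MHS U F W" and a: "a \<in> Deligne_I F W p q" and "a \<in> cW W (p + q - 1)"
  shows "a = 0"
proof -
  have incr: "incr_filtration U W" and F: "\<And>p. cvec.subspace (F p)"
    and pure: "\<And>k. pure_on_Gr F W k"
    using assms(1) by (auto simp: MHS_def decr_filtration_def)
  define C where "C k = cW W k" for k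
  note cW = incr_filtrationD[OF incr, folded C_def]
  have conj_C: "cconj v \<in> C k \<longleftrightarrow> v \<in> C k" for v k
    unfolding C_def using cW(2) by simp
  have "a \<in> F p" using a by (simp add: Deligne_I_def)
  have mem: "a \<in> C (p + q - 1 - int n)" for n
  proof (induction n)
    case 0
    show ?case using assms(3) by (simp add: C_def)
  next
    case (Suc n)
    define k where "k = p + q - 1 - int n"
    have k: "a \<in> C k" using Suc by (simp add: k_def)
    have "a \<in> cconj ` F (k + 1 - p) + C (k - 1)"
      using Deligne_I_mod_lower[OF assms(1) a, of "int n + 1", folded C_def]
      by (simp add: k_def algebra_simps)
    then obtain g w where gw: "a = g + w" "g \<in> cconj ` F (k + 1 - p)" "w \<in> C (k - 1)"
      by (rule set_plus_elim)
    have "w \<in> C k" using gw(3) cW(1)[of "k - 1" k] by auto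
    hence "a - w \<in> C k" using k cvec.subspace_diff[OF cW(3)] by blast
    hence "g \<in> C k" using gw(1) by simp
    hence "cconj g + cconj w \<in> F_Gr F W (k + 1 - p) k"
      using gw(2,3) conj_C cconj_mem_image_iff[of "cconj g"]
      by (intro mem_F_GrI[of _ F _ W, folded C_def]) auto
    moreover have "a = cconj (cconj g + cconj w)" using gw(1) by simp
    ultimately have "a \<in> cconj ` F_Gr F W (k + 1 - p) k" by blast
    moreover have "a \<in> F_Gr F W p k"
      using \<open>a \<in> F p\<close> k cW(2) by (rule F_GrI1[of _ F _ W, folded C_def])
    ultimately have "a \<in> C (k - 1)" using pure[of k, unfolded pure_on_Gr_def, folded C_def] by blast
    thus ?case by (simp add: k_def algebra_simps)
  qed
  obtain K where K: "C K = {0}" using cW(4) by blast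
  define n where "n = nat (p + q - 1 - K)"
  have "p + q - 1 - int n \<le> K" by (simp add: n_def)
  thus "a = 0" using mem[of n] cW(1) K by blast
qed

lemma int_threshold:
  fixes k0 k1 :: int
  assumes "Q k1" and "\<not> Q k0" and "k0 \<le> k1"
  shows "\<exists>k. Q k \<and> \<not> Q (k - 1)"
proof (rule ccontr)
  assume "\<not> ?thesis"
  hence step: "Q (k - 1)" if "Q k" for k using that by blast
  have "Q (k1 - int n)" for n
  proof (induction n)
    case (Suc n)
    thus ?case using step[of "k1 - int n"] by (simp add: algebra_simps)
  qed (use assms in simp)
  from this[of "nat (k1 - k0)"] show False using assms by simp
qed

lemma
  assumes "weight_filtration U N w W"
  shows weight_filtration_N: "v \<in> cW W k \<Longrightarrow> (cext N ^^ l) v \<in> cW W (k - 2 * int l)"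
    and weight_filtration_surj:
      "v \<in> cW W (w - int l) \<Longrightarrow> \<exists>x\<in>cW W (w + int l). v - (cext N ^^ l) x \<in> cW W (w - int l - 1)"
proof -
  have N: "cext N u \<in> cW W (k - 2)" if "u \<in> cW W k" for u k
    using assms that by (cases u) (auto simp: weight_filtration_def)
  show "v \<in> cW W k \<Longrightarrow> (cext N ^^ l) v \<in> cW W (k - 2 * int l)"
  proof (induction l)
    case (Suc l)
    hence "cext N ((cext N ^^ l) v) \<in> cW W (k - 2 * int l - 2)" by (intro N)
    thus ?case by (simp add: algebra_simps)
  qed auto
  have surj: "(N ^^ l) ` W (w + int l) + W (w - int l - 1) = W (w - int l)" for l
    using assms by (auto simp: weight_filtration_def)
  assume "v \<in> cW W (w - int l)"
  hence "fst v \<in> W (w - int l)" "snd v \<in> W (w - int l)" by auto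
  then obtain x1 y1 x2 y2 where
    "x1 \<in> W (w + int l)" "y1 \<in> W (w - int l - 1)" "fst v = (N ^^ l) x1 + y1"
    "x2 \<in> W (w + int l)" "y2 \<in> W (w - int l - 1)" "snd v = (N ^^ l) x2 + y2"
    unfolding surj[symmetric] by (auto elim!: set_plus_elim)
  thus "\<exists>x\<in>cW W (w + int l). v - (cext N ^^ l) x \<in> cW W (w - int l - 1)"
    by (intro bexI[of _ "(x1, x2)"]) (auto simp: cext_funpow minus_prod_def)
qed

text \<open>
The image of a projection that is compatible with all the structure inherits enough of a
polarized mixed Hodge structure to contain a primitive vector of pure Hodge type, for which the
polarization is nonzero. Only the top weight of the image is looked at: there every vector is
automatically primitive, because the surjectivity of \<open>N\<^sup>j\<close> onto weight \<open>w - j\<close> would otherwise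
call for weights that do not occur in the image.
\<close>

lemma PMHS_projection_image_nonisotropic:
  assumes PMHS: "PMHS U F W N S w" and P: "clinear P" and idem: "\<And>v. P (P v) = P v"
    and F: "\<And>p v. v \<in> F p \<Longrightarrow> P v \<in> F p" "\<And>p v. v \<in> F p \<Longrightarrow> cconj (P (cconj v)) \<in> F p"
    and W: "\<And>k v. v \<in> cW W k \<Longrightarrow> P v \<in> cW W k" "\<And>k. W k \<subseteq> U"
    and N: "\<And>v. P (cext N v) = cext N (P v)"
    and v0: "v0 \<in> U \<times> U" "P v0 \<noteq> 0"
  obtains a l where "P a = a" "bext S a ((cext N ^^ l) (cconj a)) \<noteq> 0"
proof -
  have incr: "incr_filtration U W" and Fdecr: "decr_filtration U F"
    and pure: "\<And>k. pure_on_Gr F W k" and wf: "weight_filtration U N w W" and lin: "linear N"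
    and pos: "\<And>p l a. a \<in> F_prim F W N w l p \<inter> cconj ` F_prim F W N w l (w + int l - p) \<Longrightarrow>
        a \<notin> cW W (w + int l - 1) \<Longrightarrow>
        \<i> powi (2 * p - w - int l) * bext S a ((cext N ^^ l) (cconj a)) \<in> pos_reals"
    using PMHS by (auto simp: PMHS_def MHS_def nilpotent_on_def)
  have antiF: "antimono F" and subF: "\<And>p. cvec.subspace (F p)" and "\<exists>p. F p = {0}"
    and "\<exists>p. F p = U \<times> U"
    using Fdecr by (auto simp: decr_filtration_def)
  define C where "C k = cW W k" for k
  note cW = incr_filtrationD[OF incr, folded C_def]
  note F_GrE = F_Gr_cases[where W = W, folded C_def] and F_GrI = mem_F_GrI[where W = W, folded C_def]
    and F_GrI1 = F_GrI1[where W = W, folded C_def] and F_GrI2 = F_GrI2[where W = W, folded C_def]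
  have conj_C: "cconj v \<in> C k \<longleftrightarrow> v \<in> C k" for v k
    unfolding C_def using cW(2) by simp
  have P_C: "P v \<in> C k" if "v \<in> C k" for v k using W(1)[folded C_def, OF that] .
  have C_U: "C k \<subseteq> U \<times> U" for k unfolding C_def using W(2)[of k] by auto
  have P_pow: "P ((cext N ^^ l) v) = (cext N ^^ l) (P v)" for l v
    using funpow_commuting[of P "cext N" 1 l v, OF N] by simp
  define R where "R = {v \<in> U \<times> U. P v = v}"
  have P_R: "P v \<in> R" if "v \<in> U \<times> U" for v
  proof -
    obtain j where "C j = U \<times> U" using cW(5) by blast
    thus ?thesis using P_C[of v j] that idem[of v] unfolding R_def by simp
  qed
  have P_R': "P v \<in> R" if "v \<in> C k" for v k
    using subsetD[OF C_U that] by (rule P_R)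

  \<comment> \<open>the largest weight that occurs in the image of the projection\<close>
  obtain k where k: "R \<subseteq> C k" "\<not> R \<subseteq> C (k - 1)"
  proof -
    obtain k0 where k0: "C k0 = {0}" using cW(4) by (elim exE)
    obtain k1 where k1: "C k1 = U \<times> U" using cW(5) by (elim exE)
    have "C (min k0 k1) \<subseteq> {0}"
      using cW(1)[of "min k0 k1" k0] k0 by simp
    hence "\<not> R \<subseteq> C (min k0 k1)" using P_R[OF v0(1)] v0(2) by blast
    moreover have "R \<subseteq> C k1" unfolding k1 R_def by blast
    ultimately have "\<exists>k. R \<subseteq> C k \<and> \<not> R \<subseteq> C (k - 1)"
      by (intro int_threshold[of "\<lambda>k. R \<subseteq> C k" k1 "min k0 k1"]) simp_all
    then obtain k where k: "R \<subseteq> C k \<and> \<not> R \<subseteq> C (k - 1)" ..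
    show thesis by (rule that[OF conjunct1[OF k] conjunct2[OF k]])
  qed

  \<comment> \<open>a class of weight \<open>w - j\<close> is \<open>N\<^sup>j\<close> of something in the image, which has weight at most \<open>k\<close>;
    for small \<open>k\<close> this puts the class itself into lower weight\<close>
  have lower: "v \<in> C (w - int j - 1)"
    if v: "v \<in> R" "v \<in> C (w - int j)" and j: "k - 2 * int j \<le> w - int j - 1"
      for v j
  proof -
    obtain x where x: "x \<in> C (w + int j)" "v - (cext N ^^ j) x \<in> C (w - int j - 1)"
      using weight_filtration_surj[OF wf v(2)[unfolded C_def], folded C_def] by (rule bexE)
    have "P (v - (cext N ^^ j) x) \<in> C (w - int j - 1)" by (rule P_C[OF x(2)])
    moreover have "P (v - (cext N ^^ j) x) = v - (cext N ^^ j) (P x)"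
      using v(1) by (simp add: clinear_diff[OF P] P_pow R_def)
    moreover have "P x \<in> C k" using P_R'[OF x(1)] k(1) by blast
    hence "(cext N ^^ j) (P x) \<in> C (w - int j - 1)"
      using weight_filtration_N[OF wf, of "P x" k j, folded C_def] cW(1)[OF j] by blast
    ultimately have "(v - (cext N ^^ j) (P x)) + (cext N ^^ j) (P x) \<in> C (w - int j - 1)"
      by (intro cvec.subspace_add[OF cW(3)]) simp_all
    thus ?thesis by simp
  qed
  have "k \<ge> w"
  proof (rule ccontr)
    assume "\<not> k \<ge> w"
    define j where "j = nat (w - k)"
    have j: "k = w - int j" "j > 0" using \<open>\<not> k \<ge> w\<close> by (auto simp: j_def)
    have "v \<in> C (k - 1)" if "v \<in> R" for v
      using lower[OF that, of j] subsetD[OF k(1) that] j by simp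
    hence "R \<subseteq> C (k - 1)" by (rule subsetI)
    thus False using k(2) by blast
  qed
  define l where "l = nat (k - w)"
  have l: "k = w + int l" using \<open>k \<ge> w\<close> by (simp add: l_def)

  have prim: "v \<in> primitive N w W l" if "v \<in> R" for v
  proof -
    have v: "v \<in> C k" using that k(1) by blast
    have "k - 2 * int (l + 1) = w - int (l + 2)" by (simp add: l)
    hence Nv: "(cext N ^^ (l + 1)) v \<in> C (w - int (l + 2))"
      using weight_filtration_N[OF wf v[unfolded C_def], of "l + 1", folded C_def] by metis
    have "(cext N ^^ (l + 1)) v \<in> R"
      using P_R'[OF Nv] that P_pow[of "l + 1" v] by (simp add: R_def del: funpow.simps)
    hence "(cext N ^^ (l + 1)) v \<in> C (w - int (l + 2) - 1)"
      using Nv by (rule lower) (simp add: l)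
    moreover have "w - int (l + 2) - 1 = w - int l - 3" by simp
    ultimately have "(cext N ^^ (l + 1)) v \<in> C (w - int l - 3)" by metis
    thus ?thesis using v unfolding l primitive_def C_def by blast
  qed

  \<comment> \<open>the last step of the Hodge filtration that still meets this weight in the image\<close>
  define Q where "Q = (\<lambda>p. R \<inter> F_Gr F W p k \<subseteq> C (k - 1))"
  obtain p where p: "Q (p + 1)" "\<not> Q p"
  proof -
    from \<open>\<exists>p. F p = U \<times> U\<close> obtain p0 where p0: "F p0 = U \<times> U" by (elim exE)
    from \<open>\<exists>p. F p = {0}\<close> obtain p1 where p1: "F p1 = {0}" by (elim exE)
    have "F_Gr F W p1 k \<subseteq> C (k - 1)"
    proof
      fix u assume "u \<in> F_Gr F W p1 k"
      thus "u \<in> C (k - 1)" by (rule F_GrE) (simp add: p1)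
    qed
    hence "Q p1" unfolding Q_def by (rule le_infI2)
    have "R \<subseteq> F p0" unfolding p0 R_def by blast
    also have "\<dots> \<subseteq> F (min p0 p1)" by (rule antimonoD[OF antiF]) simp
    finally have R_F: "R \<subseteq> F (min p0 p1)" .
    have "R \<subseteq> F_Gr F W (min p0 p1) k"
    proof
      fix u assume "u \<in> R"
      show "u \<in> F_Gr F W (min p0 p1) k"
        using subsetD[OF R_F \<open>u \<in> R\<close>] subsetD[OF k(1) \<open>u \<in> R\<close>] cW(2) by (rule F_GrI1)
    qed
    hence "R \<inter> F_Gr F W (min p0 p1) k = R" by (rule inf_absorb1)
    hence "\<not> Q (min p0 p1)" using k(2) unfolding Q_def by simp
    with \<open>Q p1\<close> have "\<exists>p. Q p \<and> \<not> Q (p - 1)"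
      by (rule int_threshold) simp
    then obtain p where p: "Q p \<and> \<not> Q (p - 1)" ..
    thus thesis by (intro that[of "p - 1"]) simp_all
  qed
  obtain v where v: "v \<in> R" "v \<in> F_Gr F W p k" "v \<notin> C (k - 1)"
    using p(2) unfolding Q_def by blast
  have "v \<in> cconj ` F_Gr F W (k - p) k"
  proof -
    have "v \<in> C k" by (rule subsetD[OF k(1) v(1)])
    moreover have "F_Gr F W (p + 1) k + cconj ` F_Gr F W (k + 1 - (p + 1)) k = C k"
      using pure[of k] unfolding pure_on_Gr_def C_def by blast
    ultimately have "v \<in> F_Gr F W (p + 1) k + cconj ` F_Gr F W (k - p) k" by simp
    then obtain f g where fg: "v = f + g" "f \<in> F_Gr F W (p + 1) k" "g \<in> cconj ` F_Gr F W (k - p) k"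
      by (rule set_plus_elim)
    define h where "h = cconj g"
    have h: "h \<in> F_Gr F W (k - p) k" "g = cconj h"
      using fg(3) by (auto simp: h_def)
    have "P f \<in> F_Gr F W (p + 1) k"
      using fg(2) by (rule F_GrE) (simp add: clinear_add[OF P] F_GrI F(1) P_C)
    moreover have "P f \<in> R"
      using fg(2)
    proof (rule F_GrE)
      fix x y assume "f = x + y" "x \<in> C k" "y \<in> C (k - 1)"
      moreover have "y \<in> C k" using cW(1)[of "k - 1" k] \<open>y \<in> C (k - 1)\<close> by auto
      ultimately have "f \<in> C k" using cvec.subspace_add[OF cW(3)] by simp
      thus ?thesis by (rule P_R')
    qed
    ultimately have "P f \<in> C (k - 1)" using p(1) unfolding Q_def by (meson IntI subsetD)
    hence "cconj (P f) \<in> C (k - 1)" by (simp add: conj_C)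
    hence "cconj (P f) \<in> F_Gr F W (k - p) k"
      using cvec.subspace_0[OF subF] cW(2) by (rule F_GrI2)
    moreover have "cconj (P (cconj h)) \<in> F_Gr F W (k - p) k"
      using h(1)
    proof (rule F_GrE)
      fix x y assume xy: "h = x + y" "x \<in> F (k - p)" "x \<in> C k" "y \<in> C (k - 1)"
      have "cconj (P (cconj z)) \<in> C j" if "z \<in> C j" for z j
        using that P_C[of "cconj z" j] conj_C by simp
      thus ?thesis using xy F(2) by (simp add: clinear_add[OF P] F_GrI)
    qed
    ultimately have "cconj (P f) + cconj (P (cconj h)) \<in> F_Gr F W (k - p) k"
      by (rule cvec.subspace_add[OF csubspace_F_Gr[OF subF cW(3)[unfolded C_def] cW(3)[unfolded C_def]]])
    moreover have "cconj v = cconj (P f) + cconj (P (cconj h))"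
    proof -
      have "P v = v" using v(1) unfolding R_def by simp
      moreover have "P v = P f + P (cconj h)" unfolding fg(1) h(2) by (rule clinear_add[OF P])
      ultimately have "v = P f + P (cconj h)" by (rule subst)
      thus ?thesis using cconj_add by metis
    qed
    ultimately have "cconj v \<in> F_Gr F W (k - p) k" by metis
    thus ?thesis by (simp only: cconj_mem_image_iff[symmetric])
  qed
  hence "cconj v \<in> F_Gr F W (k - p) k" by (simp only: cconj_mem_image_iff[symmetric])
  moreover have "cconj v \<in> primitive N w W l"
    using prim[OF v(1)] conj_C
    unfolding primitive_def C_def[symmetric] by (simp add: cext_funpow_cconj[OF lin] del: funpow.simps)
  ultimately have "cconj v \<in> F_prim F W N w l (w + int l - p)"
    unfolding F_prim_def l by (rule IntI)
  hence "v \<in> cconj ` F_prim F W N w l (w + int l - p)" by (simp only: cconj_mem_image_iff[symmetric])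
  moreover have "v \<in> F_prim F W N w l p"
    using v(2) prim[OF v(1)] unfolding F_prim_def l by (rule IntI)
  ultimately have "\<i> powi (2 * p - w - int l) * bext S v ((cext N ^^ l) (cconj v)) \<in> pos_reals"
    using v(3) by (intro pos) (simp_all add: C_def l)
  hence "bext S v ((cext N ^^ l) (cconj v)) \<noteq> 0" by (auto simp: pos_reals_def)
  thus thesis using that[of v l] v(1) by (simp add: R_def)
qed

section \<open>Spectral numbers in the half-open unit interval\<close>

text \<open>
The order in the definition of \<open>spec_alpha\<close> is the partial order of the complex numbers, applied to
embedded reals; it is translated back here once and for all.
\<close>

lemma spec_alpha_eqI:
  fixes \<alpha> :: real
  assumes "0 < \<alpha>" and "\<alpha> \<le> 1" and "exp (- 2 * pi * \<i> * \<alpha>) = \<zeta>"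
  shows "spec_alpha \<zeta> = \<alpha>"
  unfolding spec_alpha_def
proof (rule the_equality)
  fix \<beta> :: real
  assume asm: "0 < complex_of_real \<beta> \<and> complex_of_real \<beta> \<le> 1 \<and> exp (- 2 * pi * \<i> * \<beta>) = \<zeta>"
  hence \<beta>: "0 < \<beta>" "\<beta> \<le> 1" by (simp_all add: less_complex_def less_eq_complex_def)
  from asm have "exp (- 2 * pi * \<i> * \<beta>) = exp (- 2 * pi * \<i> * \<alpha>)" using assms by simp
  then obtain n :: int where "- 2 * pi * \<i> * \<beta> = - 2 * pi * \<i> * \<alpha> + of_int (2 * n) * pi * \<i>"
    unfolding exp_eq by blast
  hence "Im (- 2 * pi * \<i> * \<beta>) = Im (- 2 * pi * \<i> * \<alpha> + of_int (2 * n) * pi * \<i>)" by simp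
  hence "2 * pi * (\<beta> - (\<alpha> - of_int n)) = 0" by (simp add: algebra_simps)
  hence n: "\<beta> = \<alpha> - of_int n" by simp
  hence "\<bar>real_of_int n\<bar> < 1" using \<beta> assms by linarith
  hence "n = 0" by linarith
  thus "\<beta> = \<alpha>" using n by simp
qed (use assms in \<open>simp add: less_complex_def less_eq_complex_def\<close>)

lemma spec_alpha_unit:
  assumes "norm \<zeta> = 1"
  shows "0 < spec_alpha \<zeta>" and "spec_alpha \<zeta> \<le> 1" and "exp (- 2 * pi * \<i> * spec_alpha \<zeta>) = \<zeta>"
proof -
  obtain t where t: "\<zeta> = exp (\<i> * of_real t)"
    using assms complex_norm_eq_1_exp[of \<zeta>] by metis
  define \<beta> where "\<beta> = - t / (2 * pi)"
  define \<alpha> where "\<alpha> = \<beta> - of_int (\<lceil>\<beta>\<rceil> - 1)"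
  have \<alpha>: "0 < \<alpha>" "\<alpha> \<le> 1" unfolding \<alpha>_def by linarith+
  have "exp (- 2 * pi * \<i> * \<alpha>) = \<zeta>"
    unfolding t exp_eq
    by (intro exI[of _ "\<lceil>\<beta>\<rceil> - 1"]) (simp add: \<alpha>_def \<beta>_def field_simps)
  with \<alpha> show "0 < spec_alpha \<zeta>" "spec_alpha \<zeta> \<le> 1" "exp (- 2 * pi * \<i> * spec_alpha \<zeta>) = \<zeta>"
    using spec_alpha_eqI[OF \<alpha>] by auto
qed

lemma Gamma_spec_alpha_nonzero:
  assumes "norm \<zeta> = 1"
  shows "Gamma (complex_of_real (spec_alpha \<zeta>)) \<noteq> 0"
proof -
  have "complex_of_real (spec_alpha \<zeta>) \<notin> \<int>\<^sub>\<le>\<^sub>0"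
  proof
    assume "complex_of_real (spec_alpha \<zeta>) \<in> \<int>\<^sub>\<le>\<^sub>0"
    then obtain n :: int where n: "n \<le> 0" "complex_of_real (spec_alpha \<zeta>) = of_int n"
      by (auto elim!: nonpos_Ints_cases)
    hence "complex_of_real (spec_alpha \<zeta>) = complex_of_real (of_int n)" by simp
    hence "spec_alpha \<zeta> = of_int n" unfolding of_real_eq_iff .
    thus False using spec_alpha_unit(1)[OF assms] n(1) by simp
  qed
  thus ?thesis by (simp add: Gamma_eq_zero_iff)
qed

lemma exp_circle_cnj: "cnj (exp (- 2 * pi * \<i> * \<alpha>)) = exp (2 * of_real pi * \<i> * of_real \<alpha>)"
  for \<alpha> :: real
  by (simp add: exp_cnj)

lemma exp_circle_ne_1:
  fixes \<alpha> :: real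
  assumes "0 < \<alpha>" "\<alpha> < 1"
  shows "exp (2 * of_real pi * \<i> * of_real \<alpha> :: complex) \<noteq> 1"
proof
  assume "exp (2 * of_real pi * \<i> * of_real \<alpha> :: complex) = 1"
  then obtain n :: int where "2 * pi * \<alpha> = of_int (2 * n) * pi"
    by (auto simp: exp_eq_1)
  hence "2 * pi * (\<alpha> - of_int n) = 0" by (simp add: algebra_simps)
  hence "\<alpha> = of_int n" by simp
  thus False using assms by simp
qed

lemma i_powi_eq_exp: "\<i> powi n = exp (of_int n * (\<i> * pi / 2))"
proof -
  have "\<i> = exp (\<i> * pi / 2)" using exp_pi_i' cis_pi_half cis_conv_exp[of "pi / 2"] by simp
  thus ?thesis by (metis exp_power_int mult.commute)
qed

text \<open>
This polar form supplies the argument of the factor by which the Seifert form differs from the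
polarization on primitive vectors.
\<close>

lemma one_minus_exp:
  fixes \<beta> :: real
  shows "1 - exp (2 * of_real pi * \<i> * of_real \<beta>) = of_real (2 * sin (pi * \<beta>)) * exp (pi * \<i> * (\<beta> - 1 / 2))"
proof -
  let ?w = "complex_of_real (pi * \<beta>)"
  have i: "exp (pi * \<i> * (\<beta> - 1 / 2)) = exp (\<i> * ?w) * (- \<i>)"
  proof -
    have "exp (pi * \<i> * (\<beta> - 1 / 2)) = exp (\<i> * ?w) * exp (\<i> * complex_of_real (- (pi / 2)))"
      by (simp add: algebra_simps flip: exp_add)
    also have "exp (\<i> * complex_of_real (- (pi / 2))) = - \<i>"
      unfolding cis_conv_exp[symmetric] by (simp add: cis.code complex_eq_iff)
    finally show ?thesis .
  qed
  have "of_real (2 * sin (pi * \<beta>)) * exp (pi * \<i> * (\<beta> - 1 / 2)) = - (2 * \<i> * sin ?w) * exp (\<i> * ?w)"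
    unfolding i sin_of_real by simp
  also have "\<dots> = - (exp (\<i> * ?w) - exp (- (\<i> * ?w))) * exp (\<i> * ?w)"
    unfolding sin_two_i ..
  also have "\<dots> = exp (- (\<i> * ?w)) * exp (\<i> * ?w) - exp (\<i> * ?w) * exp (\<i> * ?w)"
    by (simp add: algebra_simps)
  also have "exp (- (\<i> * ?w)) * exp (\<i> * ?w) = 1" by (simp flip: exp_add)
  also have "exp (\<i> * ?w) * exp (\<i> * ?w) = exp (2 * of_real pi * \<i> * of_real \<beta>)"
    by (simp add: algebra_simps flip: exp_add)
  finally show ?thesis by simp
qed

section \<open>Steenbrink polarized mixed Hodge structures\<close>

locale steenbrink_pmhs =
  fixes m :: int and F :: "int \<Rightarrow> ('a::real_vector \<times> 'a) set" and W :: "int \<Rightarrow> 'a set"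
    and M Ms Mu N :: "'a \<Rightarrow> 'a" and S :: "'a \<Rightarrow> 'a \<Rightarrow> real"
  assumes jordan: "jordan_decomposition M Ms Mu" and N: "N = log_unipotent Mu"
    and pmhs: "Steenbrink_PMHS m F W M Ms N S"
begin

lemma semisimple_Ms: "semisimple Ms"
  and unipotent_Mu: "unipotent Mu"
  and M_eq: "M x = Ms (Mu x)" and Ms_Mu: "Ms (Mu x) = Mu (Ms x)"
  using jordan by (auto simp: jordan_decomposition_def fun_eq_iff)

lemma linear_Ms: "linear Ms" and linear_Mu: "linear Mu"
  using semisimple_Ms unipotent_Mu by (auto simp: semisimple_def unipotent_def)

lemma smhs: "Steenbrink_MHS m F W M Ms N"
  and bilinear_S: "bilinear S" and S_isometry: "S (M x) (M y) = S x y"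
  and pmhs_ne1: "PMHS (Hne1_real Ms) (\<lambda>p. F p \<inter> H_ne1 Ms) (\<lambda>k. W k \<inter> Hne1_real Ms) N S m"
  and pmhs_one: "PMHS (H1_real Ms) (\<lambda>p. F p \<inter> eigenspace Ms 1) (\<lambda>k. W k \<inter> H1_real Ms) N S (m + 1)"
  using pmhs by (auto simp: Steenbrink_PMHS_def)

lemma mhs: "MHS UNIV F W" and linear_M: "linear M" and M_W: "M ` W k = W k"
  and Ms_F: "cext Ms ` F p \<subseteq> F p" and N_F: "cext N ` F p \<subseteq> F (p - 1)"
  and weight_ne1: "weight_filtration (Hne1_real Ms) N m (\<lambda>k. W k \<inter> Hne1_real Ms)"
  and weight_one: "weight_filtration (H1_real Ms) N (m + 1) (\<lambda>k. W k \<inter> H1_real Ms)"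
  using smhs by (auto simp: Steenbrink_MHS_def)

lemma linear_N: "linear N"
  using pmhs_one by (simp add: PMHS_def nilpotent_on_def)

lemma incr_W: "incr_filtration UNIV W" and csubspace_F: "cvec.subspace (F p)"
  and decr_F: "decr_filtration UNIV F"
  using mhs by (auto simp: MHS_def decr_filtration_def)

lemmas csubspace_W = incr_filtrationD(3)[OF incr_W]

subsection \<open>The unipotent part as the exponential of its logarithm\<close>

definition X :: "'a \<Rightarrow> 'a" where "X y = Mu y - y"

lemma linear_X: "linear X"
  unfolding X_def by (intro linear_compose_sub linear_Mu linear_id[unfolded id_def])

lemma X_nilpotent: "\<exists>n. \<forall>v. (cext X ^^ n) v = 0"
proof -
  obtain n where "\<forall>x. ((\<lambda>y. Mu y - y) ^^ n) x = 0"
    using unipotent_Mu by (auto simp: unipotent_def)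
  hence "\<forall>x. (X ^^ n) x = 0" by (simp add: X_def[abs_def])
  hence "\<forall>v. (cext X ^^ n) v = 0" by (simp add: cext_funpow prod_eq_iff)
  thus ?thesis ..
qed

lemma Mu_eq: "cext Mu v = v + cext X v"
  by (cases v) (simp add: X_def)

lemma X_eigenspace: "v \<in> eigenspace Ms \<zeta> \<Longrightarrow> cext X v \<in> eigenspace Ms \<zeta>"
proof -
  assume v: "v \<in> eigenspace Ms \<zeta>"
  have "Ms (X x) = X (Ms x)" for x
    by (simp add: X_def linear_diff[OF linear_Ms] Ms_Mu)
  hence "cext Ms (cext X v) = cext X (cext Ms v)" by (cases v) simp
  also have "\<dots> = cscale \<zeta> (cext X v)"
    using v by (simp add: eigenspace_def clinear_scale[OF clinear_cext[OF linear_X]])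
  finally show ?thesis by (simp add: eigenspace_def)
qed

text \<open>
The sum in \<open>log_unipotent\<close> depends on the vector through its index set; over a common range of
indices it becomes the logarithmic series in \<open>X\<close>.
\<close>

lemma N_eq_series: "cext N v = fps_op (fps_ln 1) X v"
proof -
  obtain n where n: "\<forall>v. (cext X ^^ n) v = 0" using X_nilpotent ..
  hence X0: "(X ^^ k) x = 0" if "k \<ge> n" for k x
  proof -
    have "(X ^^ n) y = 0" for y using n spec[OF n, of "(y, y)"] by (simp add: cext_funpow prod_eq_iff)
    hence "(X ^^ (n + (k - n))) x = 0" unfolding funpow_add by simp
    thus ?thesis using that by simp
  qed
  define c :: "nat \<Rightarrow> real" where "c = (\<lambda>k. if k = 0 then 0 else (-1) ^ (k - 1) / real k)"
  have N_sum: "N x = (\<Sum>k<n. c k *\<^sub>R (X ^^ k) x)" for x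
  proof -
    have "N x = (\<Sum>k\<in>{k. k \<ge> 1 \<and> (X ^^ k) x \<noteq> 0}. ((- 1) ^ (k + 1) / real k) *\<^sub>R (X ^^ k) x)"
      unfolding N log_unipotent_def Let_def X_def[abs_def] ..
    also have "\<dots> = (\<Sum>k<n. c k *\<^sub>R (X ^^ k) x)"
      by (rule sum.mono_neutral_cong_left)
        (use X0 in \<open>auto simp: c_def not_less[symmetric] power_add gr0_conv_Suc\<close>)
    finally show ?thesis .
  qed
  have "fps_nth (fps_ln 1) k = complex_of_real (c k)" for k
    by (simp add: fps_ln_nth c_def)
  hence "fps_op (fps_ln 1) X v = (\<Sum>k<n. (c k *\<^sub>R (X ^^ k) (fst v), c k *\<^sub>R (X ^^ k) (snd v)))"
    by (simp add: nil_series_eq_sum[OF linear_X spec[OF n]] cext_funpow cscale_def)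
  also have "\<dots> = cext N v"
    by (cases v) (simp add: N_sum prod_eq_iff fst_sum snd_sum)
  finally show ?thesis by simp
qed

lemma N_nilpotent: "\<exists>n. \<forall>v. (cext N ^^ n) v = 0"
  using X_nilpotent fps_op_nilpotent[OF linear_X _ fps_ln_0 N_eq_series] by blast

lemma N_eigenspace: "v \<in> eigenspace Ms \<zeta> \<Longrightarrow> cext N v \<in> eigenspace Ms \<zeta>"
  unfolding N_eq_series using X_eigenspace
  by (intro nil_series_mem csubspace_eigen[OF semisimple_Ms]) auto

text \<open>
As \<open>N\<close> is the series \<open>ln (1 + X)\<close> and \<open>exp - 1\<close> is the compositional inverse of that series, the
substitution \<open>(exp - 1)(N)\<close> returns \<open>X\<close>.
\<close>

lemma Mu_eq_exp: "cext Mu v = fps_op (fps_exp 1) N v"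
proof -
  obtain n where n: "\<forall>v. (cext X ^^ n) v = 0" using X_nilpotent ..
  obtain n' where n': "\<forall>v. (cext N ^^ n') v = 0" using N_nilpotent ..
  have "(fps_exp 1 - 1) oo fps_ln 1 = (fps_X :: complex fps)"
    unfolding fps_ln_fps_exp_inv[OF one_neq_zero] by (rule fps_inv_right) auto
  hence "cext X v = fps_op ((fps_exp 1 - 1) oo fps_ln 1) X v"
    using fps_op_X[OF linear_X spec[OF n]] by simp
  also have "\<dots> = fps_op (fps_exp 1 - 1) N v"
    by (rule fps_op_compose[OF linear_X linear_N spec[OF n] fps_ln_0 N_eq_series])
  also have "\<dots> = fps_op (fps_exp 1) N v - v"
    using fps_op_diff[OF linear_N spec[OF n']] fps_op_one[OF linear_N spec[OF n']] by simp
  finally show ?thesis by (simp add: Mu_eq)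
qed

lemma M_eigenspace: "v \<in> eigenspace Ms \<zeta> \<Longrightarrow> cext M v = cscale \<zeta> (cext Mu v)"
proof -
  assume "v \<in> eigenspace Ms \<zeta>"
  hence "cext Mu (cext Ms v) = cscale \<zeta> (cext Mu v)"
    by (simp add: eigenspace_def clinear_scale[OF clinear_cext[OF linear_Mu]])
  moreover have "cext M v = cext Mu (cext Ms v)"
    by (cases v) (simp add: M_eq Ms_Mu)
  ultimately show ?thesis by simp
qed

lemma series_eigenspace: "v \<in> eigenspace Ms \<zeta> \<Longrightarrow> nil_series c N v \<in> eigenspace Ms \<zeta>"
  using N_eigenspace by (intro nil_series_mem csubspace_eigen[OF semisimple_Ms]) auto

lemma clinear_series: "clinear (nil_series c N)"
  using N_nilpotent clinear_nil_series[OF linear_N] by blast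

lemma component_N: "component Ms \<zeta> (cext N v) = cext N (component Ms \<zeta> v)"
  by (rule component_commute[OF semisimple_Ms clinear_cext[OF linear_N] N_eigenspace])

lemma component_F: "v \<in> F p \<Longrightarrow> component Ms \<zeta> v \<in> F p"
  by (rule component_mem_stable[OF semisimple_Ms clinear_cext[OF linear_Ms] csubspace_F Ms_F])
    (auto simp: eigenspace_def intro!: exI[of _ 1])

lemma component_W:
  assumes "v \<in> cW W k"
  shows "component Ms \<zeta> v \<in> cW W k"
proof (rule component_mem_stable[OF semisimple_Ms clinear_cext[OF linear_M] csubspace_W _ assms])
  show "cext M ` cW W k \<subseteq> cW W k" using M_W[of k] by auto
  fix \<mu> v assume v: "v \<in> eigenspace Ms \<mu>"
  obtain n where n: "\<forall>v. (cext X ^^ n) v = 0" using X_nilpotent ..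
  have "((\<lambda>w. cext M w - cscale \<mu> w) ^^ k) v = cscale (\<mu> ^ k) ((cext X ^^ k) v) \<and>
    (cext X ^^ k) v \<in> eigenspace Ms \<mu>" for k
  proof (induction k)
    case (Suc k)
    let ?u = "cscale (\<mu> ^ k) ((cext X ^^ k) v)"
    have u: "?u \<in> eigenspace Ms \<mu>"
      using Suc cvec.subspace_scale[OF csubspace_eigen[OF semisimple_Ms]] by blast
    have "((\<lambda>w. cext M w - cscale \<mu> w) ^^ Suc k) v = cext M ?u - cscale \<mu> ?u"
      using Suc by simp
    also have "\<dots> = cscale \<mu> (cext X ?u)"
      unfolding M_eigenspace[OF u] Mu_eq by (simp only: cvec.scale_right_distrib add_diff_cancel_left')
    finally show ?case
      using Suc X_eigenspace by (simp add: clinear_scale[OF clinear_cext[OF linear_X]])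
  qed (use v in auto)
  thus "\<exists>k. ((\<lambda>w. cext M w - cscale \<mu> w) ^^ k) v = 0"
    using spec[OF n, of v] by (intro exI[of _ n]) simp
qed

text \<open>
The weight filtrations of \<open>N\<close> are prescribed on the two blocks \<open>H\<^sub>1\<close> and \<open>H\<^bsub>\<noteq>1\<^esub>\<close> with different centres,
but both are lowered by 2, and \<open>W\<close> is the sum of its intersections with the blocks.
\<close>

lemma N_W:
  assumes "v \<in> cW W k"
  shows "cext N v \<in> cW W (k - 2)"
proof -
  have restrict: "cext N u \<in> cW W (k - 2)"
    if "weight_filtration V N w (\<lambda>k. W k \<inter> V)" "u \<in> cW W k" "u \<in> V \<times> V" for u V w
    using weight_filtration_N[OF that(1), of u k 1] that(2,3) by auto
  define v1 where "v1 = component Ms 1 v"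
  have v1: "v1 \<in> cW W k" unfolding v1_def by (rule component_W[OF assms])
  have v1': "v1 \<in> H1_real Ms \<times> H1_real Ms"
    unfolding real_points_eigenspace_one[OF semisimple_Ms] v1_def
    by (rule component_mem_eigenspace[OF semisimple_Ms])
  have 1: "cext N v1 \<in> cW W (k - 2)"
    by (rule restrict[OF weight_one v1 v1'])
  have v': "v - v1 \<in> Hne1_real Ms \<times> Hne1_real Ms"
    unfolding real_points_H_ne1(1)[OF semisimple_Ms] H_ne1_iff[OF semisimple_Ms] v1_def
    by (simp add: clinear_diff[OF clinear_component[OF semisimple_Ms]] component_component[OF semisimple_Ms])
  have "v - v1 \<in> cW W k" by (rule cvec.subspace_diff[OF csubspace_W assms v1])
  hence "cext N (v - v1) \<in> cW W (k - 2)" by (rule restrict[OF weight_ne1 _ v'])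
  from cvec.subspace_add[OF csubspace_W 1 this] show ?thesis
    by (simp add: clinear_diff[OF clinear_cext[OF linear_N]])
qed

lemma N_W_lower: "v \<in> cW W k \<Longrightarrow> cext N v \<in> cW W (k - 1)"
  using subsetD[OF incr_filtrationD(1)[OF incr_W, of "k - 2" "k - 1"] N_W] by simp

lemma series_W: "v \<in> cW W k \<Longrightarrow> nil_series c N v \<in> cW W k"
proof (rule nil_series_mem[OF csubspace_W])
  have *: "cW W (k - 1) \<subseteq> cW W k" by (rule incr_filtrationD(1)[OF incr_W]) simp
  show "cext N ` cW W k \<subseteq> cW W k"
    by (rule image_subsetI) (rule subsetD[OF * N_W_lower])
qed

subsection \<open>Orthogonality of eigenspaces and unimodular eigenvalues\<close>

text \<open>
The isometry \<open>M\<close> acts on the two eigenspaces by \<open>\<zeta> (1 + X)\<close> and \<open>\<mu> (1 + X)\<close>. Expanding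
\<open>S(M a, M b)\<close> leaves \<open>\<zeta> \<mu> S(a, b)\<close> and terms in which a nilpotency order has dropped, which vanish
by induction; hence \<open>S(a, b) = \<zeta> \<mu> S(a, b)\<close>.
\<close>

lemma eigenspaces_orthogonal:
  assumes "a \<in> eigenspace Ms \<zeta>" "b \<in> eigenspace Ms \<mu>" "\<zeta> * \<mu> \<noteq> 1"
  shows "bext S a b = 0"
proof -
  have "bext S a b = 0"
    if "(cext X ^^ s) a = 0" "(cext X ^^ t) b = 0" "a \<in> eigenspace Ms \<zeta>" "b \<in> eigenspace Ms \<mu>" for s t a b
    using that
  proof (induction "s + t" arbitrary: s t a b rule: less_induct)
    case less
    show ?case
    proof (cases "s = 0 \<or> t = 0")
      case True
      thus ?thesis using less.prems by (auto simp: bext_zero_left bext_zero_right bilinear_S)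
    next
      case False
      then obtain s' t' where st: "s = Suc s'" "t = Suc t'" by (meson not0_implies_Suc)
      have nil: "(cext X ^^ s') (cext X a) = 0" "(cext X ^^ t') (cext X b) = 0"
        using less.prems(1,2) by (simp_all add: st funpow_swap1)
      note Xa = X_eigenspace[OF less.prems(3)] and Xb = X_eigenspace[OF less.prems(4)]
      have "bext S (cext X a) b = 0" "bext S a (cext X b) = 0" "bext S (cext X a) (cext X b) = 0"
        using less.hyps[of s' t, OF _ nil(1) less.prems(2) Xa less.prems(4)]
          less.hyps[of s t', OF _ less.prems(1) nil(2) less.prems(3) Xb]
          less.hyps[of s' t', OF _ nil Xa Xb] by (simp_all add: st)
      moreover have "bext S a b = bext S (cext M a) (cext M b)"
        by (simp add: bext_isometry[of S M] S_isometry)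
      ultimately have "bext S a b = \<zeta> * \<mu> * bext S a b"
        unfolding M_eigenspace[OF less.prems(3)] M_eigenspace[OF less.prems(4)] Mu_eq
        by (simp add: bext_add_left bext_add_right bext_scale_left bext_scale_right bilinear_S mult_ac)
      thus ?thesis using assms(3) by simp
    qed
  qed
  thus ?thesis using X_nilpotent assms by metis
qed

text \<open>
The projection onto an eigenspace is compatible with both filtrations and with \<open>N\<close>, so some \<open>a\<close> in
\<open>H\<^sub>\<zeta>\<close> pairs nontrivially with \<open>N\<^sup>l cnj a\<close>, which lies in the eigenspace of \<open>cnj \<zeta>\<close>. Orthogonality
forces \<open>\<zeta> cnj \<zeta> = 1\<close>.
\<close>

lemma eigenvalue_unimodular:
  assumes "v \<in> eigenspace Ms \<zeta>" "v \<noteq> 0"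
  shows "norm \<zeta> = 1"
proof (cases "\<zeta> = 1")
  case False
  let ?P = "component Ms \<zeta>"
  note ss = semisimple_Ms
  have ne1: "component Ms \<mu> u \<in> H_ne1 Ms" if "\<mu> \<noteq> 1" for \<mu> u
    using eigenspace_subset_H_ne1[OF ss that component_mem_eigenspace[OF ss]] .
  have cW: "cW (\<lambda>k. W k \<inter> Hne1_real Ms) k = cW W k \<inter> H_ne1 Ms" for k
    using Times_Int_Times[of "W k" "W k" "Hne1_real Ms" "Hne1_real Ms"]
    unfolding real_points_H_ne1(1)[OF ss] by (rule sym)
  have v: "v \<in> Hne1_real Ms \<times> Hne1_real Ms"
    unfolding real_points_H_ne1(1)[OF ss] using eigenspace_subset_H_ne1[OF ss False assms(1)] .
  have Pv: "?P v \<noteq> 0" using assms by (simp add: component_eigenspace[OF ss])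
  obtain a l where a: "?P a = a" "bext S a ((cext N ^^ l) (cconj a)) \<noteq> 0"
  proof (rule PMHS_projection_image_nonisotropic[OF pmhs_ne1 clinear_component[OF ss, of \<zeta>] _ _ _ _ _ _ v Pv])
    show "?P (?P u) = ?P u" for u by (rule component_component[OF ss])
    show "?P u \<in> F p \<inter> H_ne1 Ms" if "u \<in> F p \<inter> H_ne1 Ms" for p u
      using that component_F ne1[OF False] by (simp only: Int_iff)
    show "cconj (?P (cconj u)) \<in> F p \<inter> H_ne1 Ms" if "u \<in> F p \<inter> H_ne1 Ms" for p u
      using that component_F ne1[of "cnj \<zeta>"] False
      by (simp only: Int_iff component_cconj[OF ss] cconj_cconj complex_cnj_one_iff simp_thms)
    show "?P u \<in> cW (\<lambda>k. W k \<inter> Hne1_real Ms) k" if "u \<in> cW (\<lambda>k. W k \<inter> Hne1_real Ms) k" for k u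
      using that ne1[OF False, of u] component_W[of u k \<zeta>] unfolding cW by (simp only: Int_iff)
    show "?P (cext N u) = cext N (?P u)" for u by (rule component_N)
    show "W k \<inter> Hne1_real Ms \<subseteq> Hne1_real Ms" for k by (rule Int_lower2)
  qed
  have aE: "a \<in> eigenspace Ms \<zeta>" using component_mem_eigenspace[OF ss, of \<zeta> a] a(1) by simp
  hence "(cext N ^^ l) (cconj a) \<in> eigenspace Ms (cnj \<zeta>)"
    by (intro funpow_mem[where V = "eigenspace Ms (cnj \<zeta>)"] cconj_mem_eigenspace[OF ss])
      (use N_eigenspace in auto)
  hence "\<zeta> * cnj \<zeta> = 1" using eigenspaces_orthogonal[OF aE] a(2) by blast
  hence "complex_of_real ((norm \<zeta>)\<^sup>2) = 1" by (simp only: complex_norm_square)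
  hence "(norm \<zeta>)\<^sup>2 = 1" by (simp only: of_real_eq_1_iff)
  thus ?thesis using norm_ge_zero[of \<zeta>] unfolding power2_eq_1_iff by linarith
qed simp

subsection \<open>The automorphism given by the Gamma function\<close>

lemma component_G:
  "component Ms \<zeta> (G_op Ms N v) = fps_op (gamma_fps (spec_alpha \<zeta>)) N (component Ms \<zeta> v)"
proof -
  let ?u = "\<lambda>\<mu>. fps_op (gamma_fps (spec_alpha \<mu>)) N (component Ms \<mu> v)"
  have "G_op Ms N v = sum ?u {\<mu>. component Ms \<mu> v \<noteq> 0}"
    by (simp add: G_op_def G_alpha_eq_fps_op)
  moreover have "?u \<mu> \<in> eigenspace Ms \<mu>" for \<mu>
    by (intro series_eigenspace component_mem_eigenspace[OF semisimple_Ms])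
  ultimately have "component Ms \<zeta> (G_op Ms N v) = (if component Ms \<zeta> v \<noteq> 0 then ?u \<zeta> else 0)"
    using component_sum[OF semisimple_Ms finite_components[OF semisimple_Ms], of v ?u \<zeta>] by simp
  thus ?thesis by (auto simp: nil_series_zero[OF linear_N])
qed

lemma G_eigenspace:
  assumes "v \<in> eigenspace Ms \<zeta>"
  shows "G_op Ms N v = fps_op (gamma_fps (spec_alpha \<zeta>)) N v"
  by (rule eq_if_components_eq[OF semisimple_Ms])
    (simp add: component_G component_eigenspace[OF semisimple_Ms assms]
      component_eigenspace[OF semisimple_Ms series_eigenspace[OF assms]] nil_series_zero[OF linear_N])

lemma G_mem_eigenspace: "v \<in> eigenspace Ms \<zeta> \<Longrightarrow> G_op Ms N v \<in> eigenspace Ms \<zeta>"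
  by (simp add: G_eigenspace series_eigenspace)

lemma clinear_G: "clinear (G_op Ms N)"
  by (rule clinearI; rule eq_if_components_eq[OF semisimple_Ms])
    (simp_all add: component_G clinear_add[OF clinear_component[OF semisimple_Ms]]
      clinear_scale[OF clinear_component[OF semisimple_Ms]] clinear_add[OF clinear_series]
      clinear_scale[OF clinear_series])

lemma G_commute:
  assumes T: "clinear T" and TE: "\<And>\<mu> v. v \<in> eigenspace Ms \<mu> \<Longrightarrow> T v \<in> eigenspace Ms \<mu>"
    and TN: "\<And>v. T (cext N v) = cext N (T v)"
  shows "T (G_op Ms N v) = G_op Ms N (T v)"
proof (rule eq_if_components_eq[OF semisimple_Ms])
  fix \<zeta>
  obtain n where n: "\<forall>v. (cext N ^^ n) v = 0" using N_nilpotent ..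
  show "component Ms \<zeta> (T (G_op Ms N v)) = component Ms \<zeta> (G_op Ms N (T v))"
    using nil_series_commute[OF linear_N spec[OF n] T TN]
    by (simp add: component_G component_commute[OF semisimple_Ms T TE])
qed

lemma gamma_fps_nth_0_nonzero:
  assumes "v \<in> eigenspace Ms \<zeta>" "v \<noteq> 0"
  shows "fps_nth (gamma_fps (spec_alpha \<zeta>)) 0 \<noteq> 0"
  using Gamma_spec_alpha_nonzero[OF eigenvalue_unimodular[OF assms]] by (simp add: gamma_fps_nth_0)

lemma inverse_gamma_series:
  assumes "v \<in> eigenspace Ms \<zeta>"
  shows "fps_op (inverse (gamma_fps (spec_alpha \<zeta>))) N (fps_op (gamma_fps (spec_alpha \<zeta>)) N v) = v"
    and "fps_op (gamma_fps (spec_alpha \<zeta>)) N (fps_op (inverse (gamma_fps (spec_alpha \<zeta>))) N v) = v"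
proof -
  obtain n where n: "\<forall>v. (cext N ^^ n) v = 0" using N_nilpotent ..
  note mult = fps_op_mult[OF linear_N spec[OF n], symmetric] and one = fps_op_one[OF linear_N spec[OF n]]
  show "fps_op (inverse (gamma_fps (spec_alpha \<zeta>))) N (fps_op (gamma_fps (spec_alpha \<zeta>)) N v) = v"
    "fps_op (gamma_fps (spec_alpha \<zeta>)) N (fps_op (inverse (gamma_fps (spec_alpha \<zeta>))) N v) = v"
    using gamma_fps_nth_0_nonzero[OF assms]
    by (cases "v = 0"; simp add: nil_series_zero[OF linear_N] mult one inverse_mult_eq_1
        inverse_mult_eq_1')+
qed

lemma surj_G: "range (G_op Ms N) = UNIV"
proof -
  have "\<exists>v. G_op Ms N v = x" for x
  proof -
    let ?u = "\<lambda>\<mu>. fps_op (inverse (gamma_fps (spec_alpha \<mu>))) N (component Ms \<mu> x)"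
    define v where "v = sum ?u {\<mu>. component Ms \<mu> x \<noteq> 0}"
    have "?u \<mu> \<in> eigenspace Ms \<mu>" for \<mu>
      by (intro series_eigenspace component_mem_eigenspace[OF semisimple_Ms])
    hence "component Ms \<zeta> v = (if component Ms \<zeta> x \<noteq> 0 then ?u \<zeta> else 0)" for \<zeta>
      unfolding v_def
      using component_sum[OF semisimple_Ms finite_components[OF semisimple_Ms], of x ?u \<zeta>] by simp
    hence "component Ms \<zeta> v = ?u \<zeta>" for \<zeta> by (auto simp: nil_series_zero[OF linear_N])
    hence "component Ms \<zeta> (G_op Ms N v) = component Ms \<zeta> x" for \<zeta>
      by (simp add: component_G inverse_gamma_series component_mem_eigenspace[OF semisimple_Ms])
    hence "G_op Ms N v = x" by (rule eq_if_components_eq[OF semisimple_Ms])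
    thus ?thesis ..
  qed
  thus ?thesis by (metis surj_def)
qed

lemma series_mod_lower_weight:
  assumes "v \<in> cW W k"
  obtains y where "nil_series c N v = cscale (c 0) v + y" "y \<in> cW W (k - 1)"
proof -
  obtain n where n: "\<forall>v. (cext N ^^ n) v = 0" using N_nilpotent ..
  show thesis
    by (rule that[OF nil_series_split[OF linear_N spec[OF n]]])
      (rule N_W_lower[OF series_W[OF assms]])
qed

lemma csubspace_G_F: "cvec.subspace (G_op Ms N ` F p)"
  by (rule clinear_image[OF clinear_G csubspace_F])

text \<open>
On an eigenspace \<open>G\<close> is a nonzero scalar modulo lower weight, so applying it does not change the
class of a subspace in the graded piece. Both inclusions are checked on eigencomponents.
\<close>

lemma F_Gr_G: "F_Gr (\<lambda>p. G_op Ms N ` F p) W p k = F_Gr F W p k"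
proof -
  let ?G = "G_op Ms N" and ?F' = "\<lambda>p. G_op Ms N ` F p"
  note ss = semisimple_Ms
  define C where "C k = cW W k" for k
  have subC: "cvec.subspace (C k)" for k unfolding C_def by (rule csubspace_W)
  have compC: "component Ms \<zeta> v \<in> C k" if "v \<in> C k" for \<zeta> v k
    using component_W that unfolding C_def by blast
  have seriesC: "nil_series c N v \<in> C k" if "v \<in> C k" for c v k
    using series_W that unfolding C_def by blast
  have Gr: "F_Gr F' W p k = F' p \<inter> C k + C (k - 1)" for F'
    by (simp add: F_Gr_def C_def)
  have sub: "cvec.subspace (V \<inter> C k + C (k - 1))" if "cvec.subspace V" for V
    by (intro csubspace_set_plus cvec.subspace_inter subC that)
  have le: "A \<inter> C k + C (k - 1) \<subseteq> B \<inter> C k + C (k - 1)"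
    if B: "cvec.subspace (B)" and sub12: "\<And>x. x \<in> A \<Longrightarrow> x \<in> C k \<Longrightarrow> x \<in> B \<inter> C k + C (k - 1)"
      for A B :: "('a \<times> 'a) set"
  proof
    fix z assume "z \<in> A \<inter> C k + C (k - 1)"
    then obtain x y where xy: "z = x + y" "x \<in> A \<inter> C k" "y \<in> C (k - 1)" by (rule set_plus_elim)
    have "x \<in> B \<inter> C k + C (k - 1)" using sub12 xy(2) by simp
    moreover have "0 + y \<in> B \<inter> C k + C (k - 1)"
      by (rule set_plus_intro[OF _ xy(3)]) (simp add: cvec.subspace_0 B subC)
    ultimately show "z \<in> B \<inter> C k + C (k - 1)"
      unfolding xy(1) using cvec.subspace_add[OF sub[OF B]] by simp
  qed
  show ?thesis
    unfolding Gr
  proof (rule equalityI; rule le)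
    fix x assume x: "x \<in> ?G ` F p" "x \<in> C k"
    then obtain v where v: "v \<in> F p" "x = ?G v" by (elim imageE)
    show "x \<in> F p \<inter> C k + C (k - 1)"
    proof (rule mem_if_components_mem[OF ss sub[OF csubspace_F]])
      fix \<zeta>
      let ?g = "gamma_fps (spec_alpha \<zeta>)" and ?v = "component Ms \<zeta> v" and ?x = "component Ms \<zeta> x"
      have x_v: "?x = fps_op ?g N ?v" unfolding v(2) by (rule component_G)
      have "?v = fps_op (inverse ?g) N ?x"
        unfolding x_v by (rule inverse_gamma_series(1)[OF component_mem_eigenspace[OF ss], symmetric])
      hence vC: "?v \<in> C k" using seriesC[OF compC[OF x(2)]] by metis
      obtain y where y: "?x = cscale (fps_nth ?g 0) ?v + y" "y \<in> C (k - 1)"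
        unfolding x_v C_def by (rule series_mod_lower_weight[OF vC[unfolded C_def]])
      have "cscale (fps_nth ?g 0) ?v \<in> F p \<inter> C k"
        by (intro IntI cvec.subspace_scale csubspace_F subC vC component_F v(1))
      thus "?x \<in> F p \<inter> C k + C (k - 1)" unfolding y(1) using y(2) by (rule set_plus_intro)
    qed
  next
    fix v assume v: "v \<in> F p" "v \<in> C k"
    show "v \<in> ?F' p \<inter> C k + C (k - 1)"
    proof (rule mem_if_components_mem[OF ss sub[OF csubspace_G_F]])
      fix \<zeta>
      let ?g = "gamma_fps (spec_alpha \<zeta>)" and ?v = "component Ms \<zeta> v"
      have vC: "?v \<in> C k" by (rule compC[OF v(2)])
      have Gv: "?G ?v = fps_op ?g N ?v" by (rule G_eigenspace[OF component_mem_eigenspace[OF ss]])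
      obtain y where y: "fps_op ?g N ?v = cscale (fps_nth ?g 0) ?v + y" "y \<in> C (k - 1)"
        unfolding C_def by (rule series_mod_lower_weight[OF vC[unfolded C_def]])
      let ?c = "1 / fps_nth ?g 0"
      show "?v \<in> ?F' p \<inter> C k + C (k - 1)"
      proof (cases "?v = 0")
        case True
        thus ?thesis using cvec.subspace_0[OF sub[OF csubspace_G_F]] by simp
      next
        case False
        hence "fps_nth ?g 0 \<noteq> 0"
          using gamma_fps_nth_0_nonzero[OF component_mem_eigenspace[OF ss]] by blast
        hence eq: "?v = cscale ?c (?G ?v) + cscale (- ?c) y"
          by (simp add: Gv y(1) cvec.scale_right_distrib)
        have "?G ?v \<in> ?F' p" using component_F[OF v(1)] by (rule imageI)
        moreover have "?G ?v \<in> C k" unfolding Gv by (rule seriesC[OF vC])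
        ultimately have "cscale ?c (?G ?v) \<in> ?F' p \<inter> C k"
          by (intro IntI cvec.subspace_scale csubspace_G_F subC)
        moreover have "cscale (- ?c) y \<in> C (k - 1)" by (rule cvec.subspace_scale[OF subC y(2)])
        ultimately have "cscale ?c (?G ?v) + cscale (- ?c) y \<in> ?F' p \<inter> C k + C (k - 1)"
          by (rule set_plus_intro)
        thus ?thesis unfolding eq[symmetric] .
      qed
    qed
  qed (rule csubspace_F csubspace_G_F)+
qed

lemma Ms_eigenspace: "v \<in> eigenspace Ms \<mu> \<Longrightarrow> cext Ms v \<in> eigenspace Ms \<mu>"
  using cvec.subspace_scale[OF csubspace_eigen[OF semisimple_Ms]] by (auto simp: eigenspace_def)

lemma Ms_N: "cext Ms (cext N v) = cext N (cext Ms v)"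
proof (rule eq_if_components_eq[OF semisimple_Ms])
  fix \<zeta>
  let ?v = "component Ms \<zeta> v"
  have v: "?v \<in> eigenspace Ms \<zeta>" by (rule component_mem_eigenspace[OF semisimple_Ms])
  have "cext Ms (cext N ?v) = cext N (cext Ms ?v)"
    using v N_eigenspace[OF v] by (simp add: eigenspace_def clinear_scale[OF clinear_cext[OF linear_N]])
  thus "component Ms \<zeta> (cext Ms (cext N v)) = component Ms \<zeta> (cext N (cext Ms v))"
    by (simp add: component_N
        component_commute[OF semisimple_Ms clinear_cext[OF linear_Ms] Ms_eigenspace])
qed

lemma Steenbrink_MHS_G: "Steenbrink_MHS m (\<lambda>p. G_op Ms N ` F p) W M Ms N"
proof -
  let ?F' = "\<lambda>p. G_op Ms N ` F p"
  have "decr_filtration UNIV ?F'"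
    unfolding decr_filtration_def
  proof (intro conjI allI)
    have "antimono F" using decr_F by (simp add: decr_filtration_def)
    thus "antimono ?F'" unfolding antimono_def by (meson image_mono)
    show "cvec.subspace (?F' p)" for p by (rule csubspace_G_F)
    obtain p where "F p = {0}" using decr_F unfolding decr_filtration_def by (elim conjE exE)
    hence "?F' p = {0}" by (simp add: clinear_zero[OF clinear_G])
    thus "\<exists>p. ?F' p = {0}" ..
    obtain p where "F p = UNIV \<times> UNIV" using decr_F unfolding decr_filtration_def by (elim conjE exE)
    hence "?F' p = UNIV \<times> UNIV" using surj_G by simp
    thus "\<exists>p. ?F' p = UNIV \<times> UNIV" ..
  qed
  moreover have "pure_on_Gr ?F' W k" for k
    using mhs unfolding pure_on_Gr_def F_Gr_G MHS_def by blast
  ultimately have "MHS UNIV ?F' W" using incr_W by (simp add: MHS_def)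
  moreover have "cext Ms ` ?F' p \<subseteq> ?F' p" for p
  proof (intro image_subsetI, elim imageE)
    fix x v assume "x = G_op Ms N v" "v \<in> F p"
    moreover have "cext Ms (G_op Ms N v) = G_op Ms N (cext Ms v)"
      by (rule G_commute[OF clinear_cext[OF linear_Ms] Ms_eigenspace Ms_N])
    ultimately show "cext Ms x \<in> ?F' p" using Ms_F by (metis image_eqI image_subset_iff)
  qed
  moreover have "cext N ` ?F' p \<subseteq> ?F' (p - 1)" for p
  proof (intro image_subsetI, elim imageE)
    fix x v assume "x = G_op Ms N v" "v \<in> F p"
    moreover have "cext N (G_op Ms N v) = G_op Ms N (cext N v)"
      by (rule G_commute[OF clinear_cext[OF linear_N] N_eigenspace refl])
    ultimately show "cext N x \<in> ?F' (p - 1)" using N_F by (metis image_eqI image_subset_iff)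
  qed
  ultimately show ?thesis using smhs unfolding Steenbrink_MHS_def by simp
qed

subsection \<open>The polarization and the normalized Seifert form\<close>

text \<open>
The two restrictions in the definition of a Steenbrink polarized structure, indexed by an
eigenvalue, so that the cases \<open>\<zeta> = 1\<close> and \<open>\<zeta> \<noteq> 1\<close> are treated together. The block of \<open>\<zeta>\<close> contains
the eigenspaces of \<open>\<zeta>\<close> and of \<open>cnj \<zeta>\<close>, and its structure has weight \<open>m + theta \<zeta>\<close>.
\<close>

definition block :: "complex \<Rightarrow> 'a set" where
  "block \<zeta> = (if \<zeta> = 1 then H1_real Ms else Hne1_real Ms)"

lemma pmhs_block:
  "PMHS (block \<zeta>) (\<lambda>p. F p \<inter> block \<zeta> \<times> block \<zeta>) (\<lambda>k. W k \<inter> block \<zeta>) N S (m + theta \<zeta>)"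
  using pmhs_one pmhs_ne1
  unfolding block_def theta_def
  by (simp add: real_points_H_ne1(1)[OF semisimple_Ms] real_points_eigenspace_one(1)[OF semisimple_Ms])

lemma eigenspace_block:
  assumes "v \<in> eigenspace Ms \<zeta> \<or> v \<in> eigenspace Ms (cnj \<zeta>)"
  shows "v \<in> block \<zeta> \<times> block \<zeta>"
  using assms eigenspace_subset_H_ne1[OF semisimple_Ms, of "\<zeta>" v]
    eigenspace_subset_H_ne1[OF semisimple_Ms, of "cnj \<zeta>" v]
  by (auto simp only: block_def real_points_H_ne1(1)[OF semisimple_Ms]
    real_points_eigenspace_one(1)[OF semisimple_Ms] if_True if_False complex_cnj_one_iff complex_cnj_one split: if_split)

lemma N_skew:
  assumes "a \<in> block \<zeta> \<times> block \<zeta>" "b \<in> block \<zeta> \<times> block \<zeta>"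
  shows "bext S (cext N a) b = - bext S a (cext N b)"
  using pmhs_block[of \<zeta>] unfolding PMHS_def by (intro bext_infinitesimal_isometry[OF _ assms]) blast

lemma series_adjoint:
  assumes "a \<in> block \<zeta> \<times> block \<zeta>" "b \<in> block \<zeta> \<times> block \<zeta>"
  shows "bext S (fps_op f N a) b = bext S a (fps_op (f oo - fps_X) N b)"
proof -
  obtain n where n: "\<forall>v. (cext N ^^ n) v = 0" using N_nilpotent ..
  have iso: "\<forall>x\<in>block \<zeta>. \<forall>y\<in>block \<zeta>. S (N x) y + S x (N y) = 0" and "N ` block \<zeta> \<subseteq> block \<zeta>"
    using pmhs_block[of \<zeta>] by (simp_all add: PMHS_def nilpotent_on_def)
  thus ?thesis
    by (rule bext_fps_op_adjoint[OF bilinear_S _ _ assms linear_N spec[OF n] spec[OF n]])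
qed

lemma nu_inv_ne1:
  assumes "b \<in> eigenspace Ms \<mu>" "\<mu> \<noteq> 1"
  shows "nu_inv M Ms N b = fps_op (fps_const \<mu> * fps_exp 1 - 1) N b"
proof -
  obtain n where n: "\<forall>v. (cext N ^^ n) v = 0" using N_nilpotent ..
  have "nu_inv M Ms N b = cext M b - b"
    using assms(2) by (simp add: nu_inv_def component_eigenspace[OF semisimple_Ms assms(1)] nil_series_zero[OF linear_N])
  also have "\<dots> = cscale \<mu> (fps_op (fps_exp 1) N b) - b"
    by (simp only: M_eigenspace[OF assms(1)] Mu_eq_exp)
  also have "\<dots> = fps_op (fps_const \<mu> * fps_exp 1 - 1) N b"
    by (simp only: fps_op_diff[OF linear_N spec[OF n]] fps_op_mult[OF linear_N spec[OF n]]
        fps_op_const[OF linear_N spec[OF n]] fps_op_one[OF linear_N spec[OF n]])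
  finally show ?thesis .
qed

lemma nu_inv_one:
  assumes "b \<in> eigenspace Ms 1"
  shows "nu_inv M Ms N b = - fps_op (Abs_fps (\<lambda>k. 1 / fact (k + 1))) N b"
proof -
  have "fps_nth (Abs_fps (\<lambda>k. 1 / fact (k + 1) :: complex)) = (\<lambda>k. 1 / fact (k + 1))"
    by auto
  thus ?thesis
    by (simp add: nu_inv_def component_eigenspace[OF semisimple_Ms assms]
        clinear_zero[OF clinear_cext[OF linear_M]] del: fact_Suc)
qed

lemma exp_half_eq: "exp_half N = fps_op (fps_exp (- 1 / 2)) N"
proof -
  have "fps_nth (fps_exp (- 1 / 2 :: complex)) = (\<lambda>k. (- 1 / 2) ^ k / fact k)"
    by auto
  thus ?thesis by (simp only: exp_half_def)
qed

text \<open>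
All operators in front of \<open>b\<close> are series in \<open>N\<close>, namely \<open>M - 1\<close>, \<open>exp(-N/2)\<close> and \<open>G\<close>. After \<open>G\<close> is moved
over from \<open>a\<close> as well, their product is the constant series of \<open>gamma_fps_reflection\<close>.
\<close>

theorem L_nor_G_ne1:
  fixes \<alpha> :: real
  assumes \<alpha>: "0 < \<alpha>" "\<alpha> < 1" and a: "a \<in> eigenspace Ms (exp (- 2 * pi * \<i> * \<alpha>))"
    and b: "b \<in> eigenspace Ms (cnj (exp (- 2 * pi * \<i> * \<alpha>)))"
  shows "L_nor M Ms N S (G_op Ms N a) (exp_half N (G_op Ms N b)) =
    - (2 * pi * \<i> * exp (pi * \<i> * \<alpha>)) * bext S a b"
proof -
  obtain n where n: "\<forall>v. (cext N ^^ n) v = 0" using N_nilpotent ..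
  define \<mu> where "\<mu> = exp (2 * of_real pi * \<i> * of_real \<alpha> :: complex)"
  have \<mu>: "\<mu> \<noteq> 1" unfolding \<mu>_def by (rule exp_circle_ne_1[OF \<alpha>])
  have b': "b \<in> eigenspace Ms \<mu>" using b unfolding exp_circle_cnj \<mu>_def .
  have "exp (- 2 * pi * \<i> * complex_of_real (1 - \<alpha>)) = \<mu>"
    unfolding \<mu>_def exp_eq by (intro exI[of _ "-1"]) (simp add: algebra_simps)
  hence Gb: "G_op Ms N b = fps_op (gamma_fps (1 - \<alpha>)) N b"
    using G_eigenspace[OF b'] spec_alpha_eqI[of "1 - \<alpha>" \<mu>] \<alpha> by simp
  have Ga: "G_op Ms N a = fps_op (gamma_fps \<alpha>) N a"
    using G_eigenspace[OF a] spec_alpha_eqI[of \<alpha>] \<alpha> by simp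
  let ?h = "fps_const \<mu> * fps_exp 1 - 1" and ?e = "fps_exp (- 1 / 2) * gamma_fps (1 - \<alpha>)"
  note mult = fps_op_mult[OF linear_N spec[OF n]]
  have "exp_half N (G_op Ms N b) = fps_op ?e N b" by (simp only: exp_half_eq Gb mult)
  moreover have "fps_op ?e N b \<in> eigenspace Ms \<mu>" by (rule series_eigenspace[OF b'])
  ultimately have "nu_inv M Ms N (exp_half N (G_op Ms N b)) = fps_op (?h * ?e) N b"
    using nu_inv_ne1[OF _ \<mu>] by (simp only: mult)
  hence "L_nor M Ms N S (G_op Ms N a) (exp_half N (G_op Ms N b)) =
      - bext S (fps_op (gamma_fps \<alpha>) N a) (fps_op (?h * ?e) N b)"
    by (simp only: L_nor_def Ga)
  also have "bext S (fps_op (gamma_fps \<alpha>) N a) (fps_op (?h * ?e) N b) =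
      bext S a (fps_op (gamma_fps \<alpha> oo - fps_X) N (fps_op (?h * ?e) N b))"
    using a b series_eigenspace[OF b, of "fps_nth (?h * ?e)"]
    by (intro series_adjoint[of _ "exp (- 2 * pi * \<i> * \<alpha>)"] eigenspace_block) auto
  also have "\<dots> = bext S a (fps_op (fps_const (2 * of_real pi * \<i> * exp (of_real pi * \<i> * of_real \<alpha>))) N b)"
    unfolding mult[symmetric] \<mu>_def gamma_fps_reflection[OF \<alpha>] ..
  also have "\<dots> = (2 * of_real pi * \<i> * exp (of_real pi * \<i> * of_real \<alpha>)) * bext S a b"
    unfolding fps_op_const[OF linear_N spec[OF n]] bext_scale_right[OF bilinear_S] ..
  finally show ?thesis by simp
qed

theorem L_nor_G_one:
  assumes a: "a \<in> eigenspace Ms 1" and b: "b \<in> eigenspace Ms 1"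
  shows "L_nor M Ms N S (G_op Ms N a) (exp_half N (G_op Ms N b)) = bext S a b"
proof -
  obtain n where n: "\<forall>v. (cext N ^^ n) v = 0" using N_nilpotent ..
  have "exp (- 2 * pi * \<i> * complex_of_real 1) = 1"
    unfolding exp_eq_1 by (auto intro!: exI[of _ "-1"])
  hence spec1: "spec_alpha 1 = 1" by (intro spec_alpha_eqI) auto
  let ?h = "Abs_fps (\<lambda>k. 1 / fact (k + 1))" and ?e = "fps_exp (- 1 / 2) * gamma_fps 1"
  note mult = fps_op_mult[OF linear_N spec[OF n]]
  have "exp_half N (G_op Ms N b) = fps_op ?e N b"
    by (simp only: exp_half_eq G_eigenspace[OF b] spec1 mult)
  moreover have "fps_op ?e N b \<in> eigenspace Ms 1" by (rule series_eigenspace[OF b])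
  ultimately have "nu_inv M Ms N (exp_half N (G_op Ms N b)) = - fps_op (?h * ?e) N b"
    using nu_inv_one by (simp only: mult)
  moreover have neg: "bext S x (- y) = - bext S x y" for x y
    using bext_diff_right[OF bilinear_S, of x 0 y] by (simp add: bext_zero_right[OF bilinear_S])
  ultimately have "L_nor M Ms N S (G_op Ms N a) (exp_half N (G_op Ms N b)) =
      bext S (fps_op (gamma_fps 1) N a) (fps_op (?h * ?e) N b)"
    by (simp add: L_nor_def G_eigenspace[OF a] spec1)
  also have "\<dots> = bext S a (fps_op (gamma_fps 1 oo - fps_X) N (fps_op (?h * ?e) N b))"
    using a b series_eigenspace[OF b, of "fps_nth (?h * ?e)"]
    by (intro series_adjoint[of _ 1] eigenspace_block) auto
  also have "\<dots> = bext S a b"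
    unfolding mult[symmetric] gamma_fps_reflection_one fps_op_one[OF linear_N spec[OF n]] ..
  finally show ?thesis .
qed

subsection \<open>Signs of the Seifert form on primitive vectors\<close>

lemma bext_F_zero:
  assumes "a \<in> F p \<inter> eigenspace Ms \<zeta>" "b \<in> F (m + theta \<zeta> + 1 - p) \<inter> eigenspace Ms (cnj \<zeta>)"
  shows "bext S a b = 0"
proof -
  have "\<forall>p. \<forall>a\<in>F p \<inter> block \<zeta> \<times> block \<zeta>. \<forall>b\<in>F (m + theta \<zeta> + 1 - p) \<inter> block \<zeta> \<times> block \<zeta>. bext S a b = 0"
    using pmhs_block[of \<zeta>] unfolding PMHS_def by (elim conjE)
  moreover have "a \<in> F p \<inter> block \<zeta> \<times> block \<zeta>" "b \<in> F (m + theta \<zeta> + 1 - p) \<inter> block \<zeta> \<times> block \<zeta>"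
    using assms eigenspace_block[of a \<zeta>] eigenspace_block[of b \<zeta>] by simp_all
  ultimately show ?thesis by blast
qed

text \<open>
For an eigenvector in \<open>I\<^bsup>p,q\<^esup>\<close> the two summands of its conjugate can be taken in the same eigenspace,
by projecting onto it. They then lie in the block to which the polarization refers.
\<close>

lemma cconj_Deligne_I_mod_lower:
  assumes a: "a \<in> Deligne_I F W p q" "a \<in> eigenspace Ms \<zeta>"
  obtains g y where "cconj a = g + y" "g \<in> F q" "g \<in> cW W (p + q)" "y \<in> cW W (p + q - 1)"
    "g \<in> eigenspace Ms (cnj \<zeta>)" "y \<in> eigenspace Ms (cnj \<zeta>)"
proof -
  note ss = semisimple_Ms
  define C where "C k = cW W k" for k
  note C = incr_filtrationD(1)[OF incr_W, folded C_def] csubspace_W[folded C_def] component_W[folded C_def]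
  have conj_C: "cconj v \<in> C k \<longleftrightarrow> v \<in> C k" for v k
    unfolding C_def using incr_filtrationD(2)[OF incr_W] by simp
  have "a \<in> cconj ` F q + C (p + q - 2)"
    using Deligne_I_mod_lower[OF mhs a(1), of 1, folded C_def] by (simp add: algebra_simps)
  then obtain u w where uw: "a = u + w" "u \<in> cconj ` F q" "w \<in> C (p + q - 2)"
    by (rule set_plus_elim)
  define g where "g = component Ms (cnj \<zeta>) (cconj u)"
  define y where "y = component Ms (cnj \<zeta>) (cconj w)"
  have "cconj a = component Ms (cnj \<zeta>) (cconj a)"
    using component_eigenspace[OF ss cconj_mem_eigenspace[OF ss a(2)]] by simp
  also have "\<dots> = g + y"
    unfolding uw(1) g_def y_def by (simp add: clinear_add[OF clinear_component[OF ss]])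
  finally have gy: "cconj a = g + y" .
  have g: "g \<in> F q" unfolding g_def
    using uw(2) by (intro component_F) (simp add: cconj_mem_image_iff)
  have "y \<in> C (p + q - 2)" unfolding y_def using uw(3) by (intro C(3)) (simp add: conj_C)
  hence y: "y \<in> C (p + q - 1)" "y \<in> C (p + q)"
    using C(1)[of "p + q - 2" "p + q - 1"] C(1)[of "p + q - 2" "p + q"] by auto
  have "a \<in> C (p + q)" using a(1) unfolding Deligne_I_def C_def by (elim IntE)
  hence "cconj a - y \<in> C (p + q)" by (intro cvec.subspace_diff[OF C(2)] y) (simp add: conj_C)
  hence gC: "g \<in> C (p + q)" by (simp add: gy)
  show thesis
    by (rule that[OF gy g gC[unfolded C_def] y(1)[unfolded C_def]])
      (simp_all add: g_def y_def component_mem_eigenspace[OF ss])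
qed

text \<open>
Such a vector represents a class of type \<open>(p, q)\<close> in weight \<open>p + q\<close>, primitive by the definition of
\<open>I\<^sub>0\<close> and nonzero by \<open>Deligne_I_Int_lower\<close>. Positivity is the polarization condition in the block of
\<open>\<zeta>\<close>, for which \<open>2p - w - l = p - q\<close>.
\<close>

theorem Deligne_I0_positive:
  assumes a: "a \<in> Deligne_I0 m F W Ms N p q \<zeta>" "a \<noteq> 0" and pq: "p + q = m + theta \<zeta> + int l"
  shows "\<i> powi (p - q) * bext S a ((cext N ^^ l) (cconj a)) \<in> pos_reals"
proof -
  let ?B = "block \<zeta> \<times> block \<zeta>" and ?W = "\<lambda>k. W k \<inter> block \<zeta>" and ?F = "\<lambda>p. F p \<inter> block \<zeta> \<times> block \<zeta>"
  let ?w = "m + theta \<zeta>"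
  have aI: "a \<in> Deligne_I F W p q" and aE: "a \<in> eigenspace Ms \<zeta>"
    and Na: "(cext N ^^ (l + 1)) a = 0"
    using a(1) pq by (simp_all add: Deligne_I0_def nat_add_distrib)
  have mhs_block: "MHS (block \<zeta>) ?F ?W"
    using pmhs_block[of \<zeta>] unfolding PMHS_def by (elim conjE)
  have pos: "\<forall>p l. \<forall>a \<in> F_prim ?F ?W N ?w l p \<inter> cconj ` F_prim ?F ?W N ?w l (?w + int l - p).
        a \<notin> cW ?W (?w + int l - 1) \<longrightarrow>
        \<i> powi (2 * p - ?w - int l) * bext S a ((cext N ^^ l) (cconj a)) \<in> pos_reals"
    using pmhs_block[of \<zeta>] unfolding PMHS_def by (elim conjE)
  define C where "C k = cW ?W k" for k
  have C_iff: "v \<in> C k \<longleftrightarrow> v \<in> cW W k \<and> v \<in> ?B" for v k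
    unfolding C_def Times_Int_Times[symmetric] by (rule Int_iff)
  have incr: "incr_filtration (block \<zeta>) ?W" using mhs_block by (simp add: MHS_def)
  note sub = incr_filtrationD(2)[OF incr]
  have zero: "0 \<in> C k" for k
    unfolding C_def by (rule cvec.subspace_0[OF incr_filtrationD(3)[OF incr]])
  have conj_C: "cconj v \<in> C k \<longleftrightarrow> v \<in> C k" for v k unfolding C_def using sub by simp
  have aB: "a \<in> ?B" using eigenspace_block aE by blast
  have aC: "a \<in> C (?w + int l)"
    using aI aB unfolding C_iff Deligne_I_def pq by (elim IntE) (rule conjI)
  have "a \<in> ?F p" using aI aB unfolding Deligne_I_def by (elim IntE) (rule IntI)
  hence F_Gr: "a \<in> F_Gr ?F ?W p (?w + int l)"
    using aC sub unfolding C_def by (rule F_GrI1[of a ?F])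
  have prim: "a \<in> primitive N ?w ?W l"
    using aC Na zero unfolding primitive_def C_def[symmetric] by simp
  have "cconj a \<in> F_Gr ?F ?W q (?w + int l)"
  proof -
    obtain g y where gy: "cconj a = g + y" "g \<in> F q" "g \<in> cW W (p + q)" "y \<in> cW W (p + q - 1)"
      "g \<in> eigenspace Ms (cnj \<zeta>)" "y \<in> eigenspace Ms (cnj \<zeta>)"
      by (rule cconj_Deligne_I_mod_lower[OF aI aE])
    have gB: "g \<in> ?B" and yB: "y \<in> ?B" using gy(5,6) eigenspace_block by blast+
    have "g \<in> C (?w + int l)" "y \<in> C (?w + int l - 1)"
      using gy(3,4) gB yB unfolding C_iff pq by simp_all
    moreover have "g \<in> ?F q" using gy(2) gB by (rule IntI)
    ultimately show ?thesis unfolding gy(1) C_def by (intro mem_F_GrI)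
  qed
  moreover have "cconj a \<in> primitive N ?w ?W l"
    using aC Na zero unfolding primitive_def C_def[symmetric]
    by (simp add: conj_C cext_funpow_cconj[OF linear_N] del: funpow.simps)
  ultimately have "cconj a \<in> F_prim ?F ?W N ?w l q" unfolding F_prim_def by (rule IntI)
  moreover have "?w + int l - p = q" using pq by simp
  ultimately have "a \<in> cconj ` F_prim ?F ?W N ?w l (?w + int l - p)"
    by (simp only: cconj_mem_image_iff[symmetric])
  moreover have "a \<in> F_prim ?F ?W N ?w l p" using F_Gr prim unfolding F_prim_def by (rule IntI)
  moreover have "a \<notin> cW ?W (?w + int l - 1)"
  proof
    assume "a \<in> cW ?W (?w + int l - 1)"
    hence "a \<in> cW W (p + q - 1)" unfolding C_def[symmetric] C_iff pq by (rule conjunct1)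
    hence "a = 0" by (rule Deligne_I_Int_lower[OF mhs aI])
    thus False using a(2) by contradiction
  qed
  ultimately have "\<i> powi (2 * p - ?w - int l) * bext S a ((cext N ^^ l) (cconj a)) \<in> pos_reals"
    using pos by blast
  moreover have "2 * p - ?w - int l = p - q" using pq by simp
  ultimately show ?thesis by simp
qed

text \<open>
Where \<open>N\<close> vanishes, \<open>M\<close> is the scalar \<open>\<mu>\<close> and \<open>(M - 1)/N\<close> is its constant term 1.
\<close>

lemma L_nor_annihilated:
  assumes "b \<in> eigenspace Ms \<mu>" "cext N b = 0"
  shows "L_nor M Ms N S a b = (if \<mu> = 1 then 1 else 1 - \<mu>) * bext S a b"
proof -
  have "nu_inv M Ms N b = cscale (if \<mu> = 1 then -1 else \<mu> - 1) b"
  proof (cases "\<mu> = 1")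
    case True
    thus ?thesis using nu_inv_one[of b] assms by (simp add: nil_series_annihilated[OF linear_N])
  next
    case False
    thus ?thesis using nu_inv_ne1[OF assms(1)] assms(2) by (simp add: nil_series_annihilated[OF linear_N])
  qed
  thus ?thesis by (simp add: L_nor_def bext_scale_right[OF bilinear_S] algebra_simps del: cvec.scale_minus_left)
qed

lemma N_pow_cconj_eigenspace:
  "a \<in> eigenspace Ms \<zeta> \<Longrightarrow> (cext N ^^ l) (cconj a) \<in> eigenspace Ms (cnj \<zeta>)"
  by (rule funpow_mem[OF image_subsetI[OF N_eigenspace] cconj_mem_eigenspace[OF semisimple_Ms]])

lemma L_nor_primitive:
  assumes a: "a \<in> eigenspace Ms \<zeta>" and b: "(cext N ^^ (l + 1)) b = 0" "b \<in> eigenspace Ms \<zeta>"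
  shows "L_nor M Ms N S a ((cext N ^^ l) (cconj b)) =
    (if \<zeta> = 1 then 1 else 1 - cnj \<zeta>) * bext S a ((cext N ^^ l) (cconj b))"
proof -
  have "cext N ((cext N ^^ l) (cconj b)) = 0"
    using b(1) cext_funpow_cconj[OF linear_N, of "l + 1" b] by simp
  from L_nor_annihilated[OF N_pow_cconj_eigenspace[OF b(2)] this] show ?thesis by simp
qed

text \<open>
Write \<open>G a = c a + N y\<close> with \<open>c = \<Gamma>(\<alpha>)\<close> and \<open>y\<close> a series in \<open>N\<close> applied to \<open>a\<close>. In the second argument
\<open>N\<^bsup>l+1\<^esup>\<close> kills the conjugate of \<open>y\<close>; in the first one \<open>N y\<close> contributes
\<open>- S(y, N\<^bsup>l+1\<^esup> cnj a) = 0\<close>. Only \<open>c\<close> times its conjugate remains.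
\<close>

lemma L_nor_G_primitive:
  assumes a: "a \<in> eigenspace Ms \<zeta>" and Na: "(cext N ^^ (l + 1)) a = 0"
  shows "L_nor M Ms N S (G_op Ms N a) ((cext N ^^ l) (cconj (G_op Ms N a))) =
    of_real ((cmod (Gamma (of_real (spec_alpha \<zeta>))))\<^sup>2) * L_nor M Ms N S a ((cext N ^^ l) (cconj a))"
proof -
  obtain n where n: "\<forall>v. (cext N ^^ n) v = 0" using N_nilpotent ..
  define c where "c = Gamma (complex_of_real (spec_alpha \<zeta>))"
  define y where "y = nil_series (\<lambda>k. fps_nth (gamma_fps (spec_alpha \<zeta>)) (Suc k)) N a"
  have Ga: "G_op Ms N a = cscale c a + cext N y"
    using nil_series_split[OF linear_N spec[OF n], of "fps_nth (gamma_fps (spec_alpha \<zeta>))" a]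
    unfolding G_eigenspace[OF a] y_def c_def gamma_fps_nth_0 .
  have y: "y \<in> eigenspace Ms \<zeta>" unfolding y_def by (rule series_eigenspace[OF a])
  have Ny: "(cext N ^^ (l + 1)) y = 0"
    unfolding y_def funpow_nil_series[OF linear_N spec[OF n]] Na by (rule nil_series_zero[OF linear_N])
  have NGa: "(cext N ^^ (l + 1)) (G_op Ms N a) = 0"
    unfolding G_eigenspace[OF a] funpow_nil_series[OF linear_N spec[OF n]] Na
    by (rule nil_series_zero[OF linear_N])
  note L = clinear_funpow[OF clinear_cext[OF linear_N], of l]
  let ?b = "(cext N ^^ l) (cconj a)"
  have Nb: "cext N ?b = 0"
    using Na cext_funpow_cconj[OF linear_N, of "l + 1" a] by simp
  have "(cext N ^^ l) (cconj (cext N y)) = cconj ((cext N ^^ (l + 1)) y)"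
    by (simp add: cext_funpow_cconj[OF linear_N] funpow_swap1)
  hence NlG: "(cext N ^^ l) (cconj (G_op Ms N a)) = cscale (cnj c) ?b"
    unfolding Ny Ga by (simp add: clinear_add[OF L] clinear_scale[OF L])
  have "bext S (cext N y) ?b = - bext S y (cext N ?b)"
    using y N_pow_cconj_eigenspace[OF a] by (intro N_skew[of _ \<zeta>] eigenspace_block) auto
  hence "bext S (cext N y) ?b = 0" by (simp add: Nb bext_zero_right[OF bilinear_S])
  hence "bext S (G_op Ms N a) (cscale (cnj c) ?b) = c * cnj c * bext S a ?b"
    unfolding Ga by (simp add: bext_add_left[OF bilinear_S] bext_scale_left[OF bilinear_S]
        bext_scale_right[OF bilinear_S])
  moreover have "c * cnj c = of_real ((cmod c)\<^sup>2)" by (simp only: complex_norm_square)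
  ultimately have "bext S (G_op Ms N a) ((cext N ^^ l) (cconj (G_op Ms N a))) =
      of_real ((cmod c)\<^sup>2) * bext S a ?b"
    by (simp only: NlG)
  thus ?thesis
    by (simp only: L_nor_primitive[OF G_mem_eigenspace[OF a] NGa G_mem_eigenspace[OF a]]
        L_nor_primitive[OF a Na a] c_def mult_ac)
qed

theorem L_nor_primitive_phase:
  fixes \<alpha> :: real
  assumes a: "a \<in> Deligne_I0 m F W Ms N p q \<zeta>" "a \<noteq> 0" and pq: "p + q = m + theta \<zeta> + int l"
    and \<alpha>: "exp (- 2 * pi * \<i> * \<alpha>) = \<zeta>" "\<lfloor>of_int m - \<alpha>\<rfloor> = p"
  shows "\<exists>r::real. r > 0 \<and> L_nor M Ms N S a ((cext N ^^ l) (cconj a)) =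
    exp (1 / 2 * pi * \<i> * (2 * \<alpha> + l + 1 - m)) * r"
proof -
  let ?s = "bext S a ((cext N ^^ l) (cconj a))"
  have aE: "a \<in> eigenspace Ms \<zeta>" and Na: "(cext N ^^ (l + 1)) a = 0"
    using a(1) pq by (simp_all add: Deligne_I0_def nat_add_distrib)
  obtain t :: real where t: "t > 0" "\<i> powi (p - q) * ?s = of_real t"
    using Deligne_I0_positive[OF a pq] by (auto simp: pos_reals_def)
  have "?s = \<i> powi (q - p) * (\<i> powi (p - q) * ?s)"
    by (simp flip: mult.assoc power_int_add)
  hence s: "?s = exp (of_int (q - p) * (\<i> * pi / 2)) * of_real t"
    unfolding t(2) unfolding i_powi_eq_exp .
  \<comment> \<open>\<open>\<beta>\<close> is the representative of \<open>\<alpha>\<close> in \<open>(0,1]\<close>, where the sine is positive; by the choice of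
    \<open>p\<close> as a floor the shift is \<open>m - 1 - p\<close>, and it turns the phase \<open>q - p\<close> into that of the claim\<close>
  define n where "n = m - 1 - p"
  define \<beta> where "\<beta> = \<alpha> - of_int n"
  have "of_int p \<le> of_int m - \<alpha>" "of_int m - \<alpha> < of_int p + 1"
    using \<alpha>(2) by linarith+
  hence \<beta>: "0 < \<beta>" "\<beta> \<le> 1" by (simp_all add: \<beta>_def n_def)
  have "cnj \<zeta> = exp (2 * of_real pi * \<i> * of_real \<alpha>)"
    unfolding \<alpha>(1)[symmetric] by (rule exp_circle_cnj)
  also have "\<dots> = exp (2 * of_real pi * \<i> * of_real \<beta>)"
    unfolding exp_eq by (intro exI[of _ n]) (simp add: \<beta>_def algebra_simps)
  finally have cnj: "cnj \<zeta> = exp (2 * of_real pi * \<i> * of_real \<beta>)" .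
  have \<beta>1: "\<zeta> = 1 \<longleftrightarrow> \<beta> = 1"
  proof
    assume "\<zeta> = 1"
    hence "exp (2 * of_real pi * \<i> * of_real \<beta> :: complex) = 1" using cnj by simp
    thus "\<beta> = 1" using exp_circle_ne_1[of \<beta>] \<beta> by argo
  next
    assume "\<beta> = 1"
    hence "cnj \<zeta> = 1" using cnj by (simp add: exp_eq_1)
    thus "\<zeta> = 1" by simp
  qed
  have L: "L_nor M Ms N S a ((cext N ^^ l) (cconj a)) = (if \<zeta> = 1 then 1 else 1 - cnj \<zeta>) * ?s"
    by (rule L_nor_primitive[OF aE Na aE])
  show ?thesis
  proof (cases "\<zeta> = 1")
    case True
    hence q: "q = m + 1 + int l - p" and \<alpha>_int: "\<alpha> = of_int (m - p)"
      using pq \<beta>1 by (simp_all add: theta_def \<beta>_def n_def)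
    have phase: "of_int (q - p) * (\<i> * pi / 2) = 1 / 2 * pi * \<i> * (2 * \<alpha> + l + 1 - m)"
      unfolding q \<alpha>_int by (simp add: field_simps)
    have "L_nor M Ms N S a ((cext N ^^ l) (cconj a)) =
        exp (1 / 2 * pi * \<i> * (2 * \<alpha> + l + 1 - m)) * of_real t"
      by (simp only: L s phase if_P[OF True] mult_1_left)
    thus ?thesis using t(1) by blast
  next
    case False
    hence "\<beta> < 1" using \<beta>1 \<beta>(2) by simp
    hence sin: "sin (pi * \<beta>) > 0" using \<beta>(1) by (intro sin_gt_zero) auto
    have q: "q = m + int l - p" using pq False by (simp add: theta_def)
    have phase: "pi * \<i> * (\<beta> - 1 / 2) + of_int (q - p) * (\<i> * pi / 2) = 1 / 2 * pi * \<i> * (2 * \<alpha> + l + 1 - m)"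
      by (simp add: q \<beta>_def n_def field_simps)
    have "L_nor M Ms N S a ((cext N ^^ l) (cconj a)) =
        (exp (pi * \<i> * (\<beta> - 1 / 2)) * exp (of_int (q - p) * (\<i> * pi / 2))) * of_real (2 * sin (pi * \<beta>) * t)"
      unfolding L s cnj one_minus_exp using False by (simp add: mult_ac)
    also have "\<dots> = exp (1 / 2 * pi * \<i> * (2 * \<alpha> + l + 1 - m)) * of_real (2 * sin (pi * \<beta>) * t)"
      unfolding exp_add[symmetric] phase ..
    finally show ?thesis using sin t(1) by (intro exI[of _ "2 * sin (pi * \<beta>) * t"]) simp
  qed
qed

end

theorem theorem4p3:
  fixes F :: "int \<Rightarrow> ('a::real_vector \<times> 'a) set" and W :: "int \<Rightarrow> 'a set"
    and M Ms Mu N :: "'a \<Rightarrow> 'a" and S :: "'a \<Rightarrow> 'a \<Rightarrow> real" and m :: int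
    and H :: "complex \<Rightarrow> ('a \<times> 'a) set" and G :: "'a \<times> 'a \<Rightarrow> 'a \<times> 'a"
    and L :: "'a \<times> 'a \<Rightarrow> 'a \<times> 'a \<Rightarrow> complex"
  assumes fin_dim: "\<exists>B::'a set. finite B \<and> span B = UNIV"
    and jordan: "jordan_decomposition M Ms Mu" and N: "N = log_unipotent Mu"
    and pmhs: "Steenbrink_PMHS m F W M Ms N S"
    and H: "H = eigenspace Ms" and G: "G = G_op Ms N" and L: "L = L_nor M Ms N S"
  shows
    "((\<forall>(\<alpha>::real) a b. 0 < \<alpha> \<and> \<alpha> < 1 \<and>
        a \<in> H (exp (- 2 * pi * \<i> * \<alpha>)) \<and> b \<in> H (cnj (exp (- 2 * pi * \<i> * \<alpha>))) \<longrightarrow>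
        bext S a b = - 1 / (2 * pi * \<i>) * exp (- pi * \<i> * \<alpha>) * L (G a) (exp_half N (G b))) \<and>
     (\<forall>a\<in>H 1. \<forall>b\<in>H 1. bext S a b = L (G a) (exp_half N (G b)))) \<and>
     (Steenbrink_MHS m (\<lambda>p. G ` F p) W M Ms N \<and>
     (\<forall>p \<zeta> \<kappa>. \<zeta> \<noteq> 1 \<and> \<kappa>\<^sup>2 = \<zeta> \<longrightarrow>
        (\<forall>a \<in> G ` (F p \<inter> H \<zeta>). \<forall>b \<in> G ` (F (m + 1 - p) \<inter> H (cnj \<zeta>)).
           L_sym M Ms N S (\<kappa> * \<i> powi (m - 1)) a b = 0)) \<and>
     (\<forall>p. \<forall>a \<in> G ` (F p \<inter> H 1). \<forall>b \<in> G ` (F (m + 2 - p) \<inter> H 1).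
        L_sym M Ms N S (\<i> powi (m - 1)) a b = 0)) \<and>
     (\<forall>p q \<zeta> l (\<alpha>::real) a.
       m + theta \<zeta> \<le> p + q \<and> Deligne_I0 m F W Ms N p q \<zeta> \<noteq> {0} \<and>
       l = nat (p + q - m - theta \<zeta>) \<and>
       exp (- 2 * pi * \<i> * \<alpha>) = \<zeta> \<and> \<lfloor>of_int m - \<alpha>\<rfloor> = p \<and>
       (a \<in> Deligne_I0 m F W Ms N p q \<zeta> - {0} \<or>
        a \<in> G ` Deligne_I0 m F W Ms N p q \<zeta> - {0}) \<longrightarrow>
       (\<exists>r::real>0. L a ((cext N ^^ l) (cconj a)) =
          exp (1 / 2 * pi * \<i> * (2 * \<alpha> + l + 1 - m)) * r))"
proof -
  interpret steenbrink_pmhs m F W M Ms Mu N S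
    by unfold_locales (rule jordan N pmhs)+
  have G_zero: "G_op Ms N 0 = 0" by (rule clinear_zero[OF clinear_G])
  have part_a_ne1: "bext S a b = - 1 / (2 * pi * \<i>) * exp (- pi * \<i> * \<alpha>) * L (G a) (exp_half N (G b))"
    if \<alpha>: "0 < \<alpha>" "\<alpha> < 1" and ab: "a \<in> H (exp (- 2 * pi * \<i> * \<alpha>))"
      "b \<in> H (cnj (exp (- 2 * pi * \<i> * \<alpha>)))" for \<alpha> :: real and a b
  proof -
    have "exp (- pi * \<i> * \<alpha>) * exp (pi * \<i> * \<alpha>) = 1" by (simp flip: exp_add)
    moreover have "L (G a) (exp_half N (G b)) = - (2 * pi * \<i> * exp (pi * \<i> * \<alpha>)) * bext S a b"
      unfolding L G using ab by (intro L_nor_G_ne1[OF \<alpha>]) (simp_all only: H)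
    ultimately show ?thesis by (simp add: field_simps)
  qed
  have part_a_one: "bext S a b = L (G a) (exp_half N (G b))" if "a \<in> H 1" "b \<in> H 1" for a b
    using L_nor_G_one[of a b] that unfolding H L G by simp
  have part_b_ne1: "L_sym M Ms N S \<rho> (G a) (G b) = 0"
    if "\<zeta> \<noteq> 1" and a: "a \<in> F p \<inter> H \<zeta>" and b: "b \<in> F (m + 1 - p) \<inter> H (cnj \<zeta>)" for p \<zeta> \<rho> a b
  proof (cases "a = 0")
    case True
    thus ?thesis by (simp add: L_sym_def L_nor_def G G_zero bext_zero_left[OF bilinear_S])
  next
    case False
    hence "norm \<zeta> = 1" using a eigenvalue_unimodular unfolding H by blast
    note \<alpha> = spec_alpha_unit[OF this]
    have "exp (- 2 * pi * \<i> * complex_of_real 1) = 1"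
      unfolding exp_eq_1 by (auto intro!: exI[of _ "-1"])
    hence "spec_alpha \<zeta> \<noteq> 1" using \<alpha>(3) \<open>\<zeta> \<noteq> 1\<close> by metis
    hence lt: "spec_alpha \<zeta> < 1" using \<alpha>(2) by simp
    have "bext S a b = 0"
      using a b \<open>\<zeta> \<noteq> 1\<close> unfolding H by (intro bext_F_zero[of a p \<zeta> b]) (simp_all add: theta_def)
    moreover have "L_nor M Ms N S (G a) (exp_half N (G b)) =
        - (2 * pi * \<i> * exp (pi * \<i> * spec_alpha \<zeta>)) * bext S a b"
      unfolding G using a b
      by (intro L_nor_G_ne1[OF \<alpha>(1) lt]) (simp_all only: \<alpha>(3) H Int_iff)
    ultimately show ?thesis by (simp add: L_sym_def)
  qed
  have part_b_one: "L_sym M Ms N S \<rho> (G a) (G b) = 0"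
    if a: "a \<in> F p \<inter> H 1" and b: "b \<in> F (m + 2 - p) \<inter> H 1" for p \<rho> a b
  proof -
    have "bext S a b = 0"
      using a b unfolding H by (intro bext_F_zero[of a p 1 b]) (simp_all add: theta_def add.commute)
    thus ?thesis using L_nor_G_one[of a b] a b unfolding L_sym_def G H by simp
  qed
  have part_c: "\<exists>r::real. r > 0 \<and> L a ((cext N ^^ l) (cconj a)) =
      exp (1 / 2 * pi * \<i> * (2 * \<alpha> + l + 1 - m)) * r"
    if le: "m + theta \<zeta> \<le> p + q" and l: "l = nat (p + q - m - theta \<zeta>)"
      and \<alpha>: "exp (- 2 * pi * \<i> * \<alpha>) = \<zeta>" "\<lfloor>of_int m - \<alpha>\<rfloor> = p"
      and a: "a \<in> Deligne_I0 m F W Ms N p q \<zeta> - {0} \<or>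
        a \<in> G ` Deligne_I0 m F W Ms N p q \<zeta> - {0}"
    for p q \<zeta> l a and \<alpha> :: real
    using a
  proof
    have pq: "p + q = m + theta \<zeta> + int l" using le l by simp
    note phase = L_nor_primitive_phase[OF _ _ pq \<alpha>]
    show ?thesis if "a \<in> Deligne_I0 m F W Ms N p q \<zeta> - {0}"
      using phase[of a] that unfolding L by simp
    assume "a \<in> G ` Deligne_I0 m F W Ms N p q \<zeta> - {0}"
    then obtain b where b: "b \<in> Deligne_I0 m F W Ms N p q \<zeta>" "a = G b" "a \<noteq> 0" by blast
    hence "b \<noteq> 0" using G_zero G by metis
    have bE: "b \<in> eigenspace Ms \<zeta>" and Nb: "(cext N ^^ (l + 1)) b = 0"
      using b(1) pq by (simp_all add: Deligne_I0_def nat_add_distrib)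
    let ?c = "(cmod (Gamma (of_real (spec_alpha \<zeta>))))\<^sup>2"
    have "?c > 0"
      using Gamma_spec_alpha_nonzero[OF eigenvalue_unimodular[OF bE \<open>b \<noteq> 0\<close>]] by simp
    moreover obtain r :: real where r: "r > 0" "L_nor M Ms N S b ((cext N ^^ l) (cconj b)) =
        exp (1 / 2 * pi * \<i> * (2 * \<alpha> + l + 1 - m)) * r"
      using phase[OF b(1) \<open>b \<noteq> 0\<close>] by blast
    ultimately have "?c * r > 0" by simp
    moreover have "L a ((cext N ^^ l) (cconj a)) =
        exp (1 / 2 * pi * \<i> * (2 * \<alpha> + l + 1 - m)) * of_real (?c * r)"
      unfolding L b(2) G L_nor_G_primitive[OF bE Nb] r(2) by (simp only: of_real_mult mult_ac)
    ultimately show ?thesis by blast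
  qed
  show ?thesis
  proof (intro conjI)
    show "\<forall>(\<alpha>::real) a b. 0 < \<alpha> \<and> \<alpha> < 1 \<and>
        a \<in> H (exp (- 2 * pi * \<i> * \<alpha>)) \<and> b \<in> H (cnj (exp (- 2 * pi * \<i> * \<alpha>))) \<longrightarrow>
        bext S a b = - 1 / (2 * pi * \<i>) * exp (- pi * \<i> * \<alpha>) * L (G a) (exp_half N (G b))"
      using part_a_ne1 by (simp add: less_complex_def)
    show "\<forall>a\<in>H 1. \<forall>b\<in>H 1. bext S a b = L (G a) (exp_half N (G b))"
      by (intro ballI part_a_one)
    show "Steenbrink_MHS m (\<lambda>p. G ` F p) W M Ms N"
      unfolding G by (rule Steenbrink_MHS_G)
  qed (use part_b_ne1 part_b_one part_c in \<open>blast+\<close>)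
qed

end
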